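(* Let $p\colon E\to X$ be a Lipschitz submersion of metric spaces, where $X$ is locally compact and locally connected. Let $y\in E$, $b=p(y)$, $F=p^{-1}(b)$, and assume that $F$ is locally compact and locally connected and that $\mathcal{L}^{*}(F)$ holds. Let $U$ and $V$ be open subsets of $F$ and let $f\colon U\times N_1\to E$ and $g\colon V\times N_2\to E$ be Lipschitz product charts for $p$ about $U$ and $V$, respectively. Let $A$ and $B$ be compact subsets of $F$ such that $U$ and $V$ are open neighborhoods of $A$ and $B$, respectively. Then there exist an open neighborhood $W$ of $A\cup B$ in $F$, a neighborhood $N$ of $b$ in $X$, and a Lipschitz product chart $h\colon W\times N\to E$ about $W$ for $p$ such that $h=f$ near $A\times\{b\}$ and $h=g$ near $(B-U)\times\{b\}$.
   Context: Lipschitz is a local condition: a map $f\colon X\to Y$ of metric spaces is Lipschitz if every $x\in X$ has an open neighborhood on which $f$ satisfies $d_Y(f(x'),f(x''))\le L_x d_X(x',x'')$ for some constant $L_x$. It is a Lipschitz embedding if it is injective and both $f\colon X\to f(X)$ and $f^{-1}\colon f(X)\to X$ are Lipschitz; a Lipschitz isomorphism is a bijective Lipschitz embedding. An open Lipschitz embedding is a Lipschitz embedding that is an open map. Products carry the sum metric; subsets carry the restricted metric. Two maps agree near a set if they agree on some neighborhood of it. Lipschitz submersion and product chart: a Lipschitz map $p\colon E\to X$ is a Lipschitz submersion if for each $y\in E$ there exist an open neighborhood $U$ of $y$ in $F=p^{-1}(p(y))$, a neighborhood $N$ of $p(y)$ in $X$, and an open Lipschitz embedding $f\colon U\times N\to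 E$ onto a neighborhood of $y$ such that $p\circ f\colon U\times N\to N$ is the projection and $f(u,p(y))=u$ for all $u\in U$. In general, for $U$ open in a fiber $F=p^{-1}(b)$ and $N$ a neighborhood of $b$ in $X$, a Lipschitz product chart about $U$ for $p$ is an open Lipschitz embedding $f\colon U\times N\to E$ with $p\circ f$ the projection to $N$ and $f(u,b)=u$ for all $u\in U$. Lipschitz isotopy: for metric spaces $Z,U,Y$, a family $h_t\colon U\to Y$ ($t\in Z$) gives a Lipschitz isotopy if the map $Z\times U\to Z\times Y$, $(t,x)\mapsto(t,h_t(x))$, is an open embedding that is a Lipschitz isomorphism onto its image. $\mathcal{L}^{*}(Y)$, for a metric space $Y$: for every open $U\subseteq Y$ and compact $D\subseteq U$ the following holds. For every open Lipschitz embedding $h\colon U\to Y$ sufficiently near the inclusion $i\colon U\to Y$ (in the compact-open topology) there is a Lipschitz isomorphism $h'\colon Y\to Y$ with $h'=h$ on $D$ and $h'$ equal to the identity on $Y-U$; the rule $h\mapsto h'$ is continuous in $h$ for $h$ sufficiently near $i$ and sends $i$ to $\mathrm{id}_Y$; and moreover (P): for every metric space $Z$, if $h_t\colon U\to Y$ ($t\in Z$) gives a Lipschitz isotopy such that the rule $h_t\mapsto h_t'$ is well defined for all $t\in Z$, then $h'_t\colon Y\to Y$ ($t\in Z$) gives a Lipschitz isotopy. *)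

theory Defs
  imports "HOL-Analysis.Analysis"
begin

definition nbhd_of :: "'a topology \<Rightarrow> 'a set \<Rightarrow> 'a set \<Rightarrow> bool" where
  "nbhd_of T S N \<longleftrightarrow> N \<subseteq> topspace T \<and> (\<exists>Q. openin T Q \<and> S \<subseteq> Q \<and> Q \<subseteq> N)"

text \<open>The common neighbourhood is required to lie in both domains \<open>D\<close> and \<open>D'\<close>, since the
  maps are represented by total functions whose values elsewhere are meaningless.\<close>

definition agree_near ::
  "'a topology \<Rightarrow> 'a set \<Rightarrow> 'a set \<Rightarrow> ('a \<Rightarrow> 'b) \<Rightarrow> 'a set \<Rightarrow> ('a \<Rightarrow> 'b) \<Rightarrow> bool" where
  "agree_near T S D f D' g \<longleftrightarrow>
     (\<exists>Q. nbhd_of T S Q \<and> Q \<subseteq> D \<inter> D' \<and> (\<forall>x\<in>Q. f x = g x))"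

text \<open>The library's \<^const>\<open>prod_metric\<close> is the Euclidean product metric; here products carry
  the sum metric.\<close>

definition sum_metric :: "'a metric \<Rightarrow> 'b metric \<Rightarrow> ('a \<times> 'b) metric" where
  "sum_metric M N =
     metric (mspace M \<times> mspace N,
             \<lambda>p q. mdist M (fst p) (fst q) + mdist N (snd p) (snd q))"

lemma Metric_space_sum_metric:
  "Metric_space (mspace M \<times> mspace N)
     (\<lambda>p q. mdist M (fst p) (fst q) + mdist N (snd p) (snd q))"
proof
  fix p q r
  show "0 \<le> mdist M (fst p) (fst q) + mdist N (snd p) (snd q)"
    by simp
  show "mdist M (fst p) (fst q) + mdist N (snd p) (snd q) =
        mdist M (fst q) (fst p) + mdist N (snd q) (snd p)"
    by (simp add: mdist_commute)
  assume p: "p \<in> mspace M \<times> mspace N" and q: "q \<in> mspace M \<times> mspace N"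
  show "(mdist M (fst p) (fst q) + mdist N (snd p) (snd q) = 0) \<longleftrightarrow> p = q"
    using p q by (auto simp: add_nonneg_eq_0_iff mdist_zero prod_eq_iff)
  assume r: "r \<in> mspace M \<times> mspace N"
  have "mdist M (fst p) (fst r) \<le> mdist M (fst p) (fst q) + mdist M (fst q) (fst r)"
    using p q r by (intro mdist_triangle) auto
  moreover
  have "mdist N (snd p) (snd r) \<le> mdist N (snd p) (snd q) + mdist N (snd q) (snd r)"
    using p q r by (intro mdist_triangle) auto
  ultimately
  show "mdist M (fst p) (fst r) + mdist N (snd p) (snd r) \<le>
        mdist M (fst p) (fst q) + mdist N (snd p) (snd q) +
        (mdist M (fst q) (fst r) + mdist N (snd q) (snd r))"
    by linarith
qed

lemma mspace_sum_metric [simp]: "mspace (sum_metric M N) = mspace M \<times> mspace N"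
  unfolding sum_metric_def by (rule Metric_space.mspace_metric[OF Metric_space_sum_metric])

lemma mdist_sum_metric [simp]:
  "mdist (sum_metric M N) =
     (\<lambda>p q. mdist M (fst p) (fst q) + mdist N (snd p) (snd q))"
  unfolding sum_metric_def by (rule Metric_space.mdist_metric[OF Metric_space_sum_metric])

text \<open>``Lipschitz'' means locally Lipschitz throughout, in contrast to the library's global
  notion \<^const>\<open>Lipschitz_continuous_map\<close>.\<close>

definition lipschitz_map :: "'a metric \<Rightarrow> 'b metric \<Rightarrow> ('a \<Rightarrow> 'b) \<Rightarrow> bool" where
  "lipschitz_map M N f \<longleftrightarrow>
     f \<in> mspace M \<rightarrow> mspace N \<and>
     (\<forall>x\<in>mspace M. \<exists>Q. openin (mtopology_of M) Q \<and> x \<in> Q \<and>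
        Lipschitz_continuous_map (submetric M Q) N f)"

definition lipschitz_embedding :: "'a metric \<Rightarrow> 'b metric \<Rightarrow> ('a \<Rightarrow> 'b) \<Rightarrow> bool" where
  "lipschitz_embedding M N f \<longleftrightarrow>
     f \<in> mspace M \<rightarrow> mspace N \<and> inj_on f (mspace M) \<and>
     lipschitz_map M (submetric N (f ` mspace M)) f \<and>
     lipschitz_map (submetric N (f ` mspace M)) M (inv_into (mspace M) f)"

definition lipschitz_isomorphism :: "'a metric \<Rightarrow> 'b metric \<Rightarrow> ('a \<Rightarrow> 'b) \<Rightarrow> bool" where
  "lipschitz_isomorphism M N f \<longleftrightarrow>
     lipschitz_embedding M N f \<and> bij_betw f (mspace M) (mspace N)"

definition open_lipschitz_embedding :: "'a metric \<Rightarrow> 'b metric \<Rightarrow> ('a \<Rightarrow> 'b) \<Rightarrow> bool" where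
  "open_lipschitz_embedding M N f \<longleftrightarrow>
     lipschitz_embedding M N f \<and> open_map (mtopology_of M) (mtopology_of N) f"

definition fiber :: "'e metric \<Rightarrow> ('e \<Rightarrow> 'x) \<Rightarrow> 'x \<Rightarrow> 'e metric" where
  "fiber E p b = submetric E {e \<in> mspace E. p e = b}"

definition lipschitz_product_chart ::
  "'e metric \<Rightarrow> 'x metric \<Rightarrow> ('e \<Rightarrow> 'x) \<Rightarrow> 'x \<Rightarrow> 'e set \<Rightarrow> 'x set \<Rightarrow> ('e \<times> 'x \<Rightarrow> 'e) \<Rightarrow> bool"
where
  "lipschitz_product_chart E X p b U N f \<longleftrightarrow>
     openin (mtopology_of (fiber E p b)) U \<and>
     nbhd_of (mtopology_of X) {b} N \<and>
     open_lipschitz_embedding (sum_metric (submetric (fiber E p b) U) (submetric X N)) E f \<and>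
     (\<forall>u\<in>U. \<forall>x\<in>N. p (f (u, x)) = x) \<and>
     (\<forall>u\<in>U. f (u, b) = u)"

definition lipschitz_submersion :: "'e metric \<Rightarrow> 'x metric \<Rightarrow> ('e \<Rightarrow> 'x) \<Rightarrow> bool" where
  "lipschitz_submersion E X p \<longleftrightarrow>
     lipschitz_map E X p \<and>
     (\<forall>y\<in>mspace E. \<exists>U N f. y \<in> U \<and>
        lipschitz_product_chart E X p (p y) U N f \<and>
        nbhd_of (mtopology_of E) {y} (f ` (U \<times> N)))"

definition lipschitz_isotopy ::
  "'z metric \<Rightarrow> 'u metric \<Rightarrow> 'y metric \<Rightarrow> ('z \<Rightarrow> 'u \<Rightarrow> 'y) \<Rightarrow> bool" where
  "lipschitz_isotopy Z U Y h \<longleftrightarrow>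
     open_lipschitz_embedding (sum_metric Z U) (sum_metric Z Y) (\<lambda>(t, x). (t, h t x))"

text \<open>Points of the function spaces are extensional functions, so that a map with domain
  \<open>topspace S\<close> is a single element.\<close>

definition compact_open_topology :: "'a topology \<Rightarrow> 'b topology \<Rightarrow> ('a \<Rightarrow> 'b) topology" where
  "compact_open_topology S T =
     topology_generated_by
       {{f \<in> extensional (topspace S). continuous_map S T f \<and> f ` K \<subseteq> Q} | K Q.
          compactin S K \<and> openin T Q}"

definition open_embedding_space :: "'a metric \<Rightarrow> 'a set \<Rightarrow> ('a \<Rightarrow> 'a) topology" where
  "open_embedding_space Y U =
     subtopology (compact_open_topology (mtopology_of (submetric Y U)) (mtopology_of Y))
       {h. open_lipschitz_embedding (submetric Y U) Y h}"

definition lipschitz_automorphism_space :: "'a metric \<Rightarrow> ('a \<Rightarrow> 'a) topology" where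
  "lipschitz_automorphism_space Y =
     subtopology (compact_open_topology (mtopology_of Y) (mtopology_of Y))
       {h. lipschitz_isomorphism Y Y h}"

text \<open>The condition \<open>\<L>\<^sup>*(Y)\<close>. The rule \<open>h \<mapsto> h'\<close> is \<open>\<Phi>\<close>, defined on an open neighbourhood
  \<open>\<N>\<close> of the inclusion; in (P), \<open>h\<^sub>t'\<close> is well defined for all \<open>t\<close> iff every \<open>h\<^sub>t\<close> lies in \<open>\<N>\<close>.
  HOL cannot quantify over all types, so the parameter spaces \<open>Z\<close> in (P) range over all metric
  spaces whose points are taken from the type given by the first argument.\<close>

definition Lstar :: "'z itself \<Rightarrow> 'a metric \<Rightarrow> bool" where
  "Lstar (_ :: 'z itself) Y \<longleftrightarrow>
     (\<forall>U D. openin (mtopology_of Y) U \<and> compactin (mtopology_of Y) D \<and> D \<subseteq> U \<longrightarrow>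
       (\<exists>\<N> \<Phi>.
          openin (open_embedding_space Y U) \<N> \<and>
          restrict id U \<in> \<N> \<and>
          continuous_map (subtopology (open_embedding_space Y U) \<N>)
            (lipschitz_automorphism_space Y) \<Phi> \<and>
          \<Phi> (restrict id U) = restrict id (mspace Y) \<and>
          (\<forall>h\<in>\<N>. (\<forall>x\<in>D. \<Phi> h x = h x) \<and> (\<forall>x\<in>mspace Y - U. \<Phi> h x = x)) \<and>
          (\<forall>(Z :: 'z metric) h.
             (\<forall>t\<in>mspace Z. h t \<in> \<N>) \<and> lipschitz_isotopy Z (submetric Y U) Y h \<longrightarrow>
             lipschitz_isotopy Z Y Y (\<lambda>t. \<Phi> (h t)))))"

end

theory Submission
  imports Defs
begin

text \<open>
  Choose compact neighbourhoods \<open>A1 \<subseteq> U\<close> of \<open>A\<close> and \<open>B1 \<subseteq> V\<close> of \<open>B\<close>, put \<open>D = A1 \<inter> B1\<close>, and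
  let \<open>G\<close> be a relatively compact open neighbourhood of \<open>D\<close> in \<open>U \<inter> V\<close>. For \<open>t\<close> near \<open>b\<close> the
  transition maps \<open>\<phi>\<^sub>t = g\<^sub>t\<inverse> \<circ> f\<^sub>t\<close> are defined on \<open>G\<close> and form a Lipschitz isotopy with
  \<open>\<phi>\<^sub>b = id\<close>. The condition \<open>\<L>\<^sup>*(F)\<close> extends them to automorphisms \<open>\<psi>\<^sub>t\<close> of \<open>F\<close> that equal
  \<open>\<phi>\<^sub>t\<close> on \<open>D\<close> and the identity off \<open>G\<close>, and (P) makes \<open>g'\<^sub>t = g\<^sub>t \<circ> \<psi>\<^sub>t\<close> a product chart. It
  agrees with \<open>f\<close> over \<open>D\<close> and with \<open>g\<close> off \<open>G\<close>, so \<open>f\<close> on \<open>A1\<close> and \<open>g'\<close> near \<open>B\<close> fit together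
  to a local embedding; it is injective for \<open>t\<close> close to \<open>b\<close> by compactness.
\<close>

subsection \<open>Sum metrics and submetrics\<close>

lemma openin_mtopology_of_subset: "openin (mtopology_of M) Q \<Longrightarrow> Q \<subseteq> mspace M"
  using openin_subset by fastforce

lemma openin_mtopology_of:
  "openin (mtopology_of M) S \<longleftrightarrow>
     S \<subseteq> mspace M \<and> (\<forall>x\<in>S. \<exists>r>0. \<forall>z\<in>mspace M. mdist M x z < r \<longrightarrow> z \<in> S)"
proof -
  interpret Metric_space "mspace M" "mdist M"
    by (rule Metric_space_mspace_mdist)
  have "mball x r \<subseteq> S \<longleftrightarrow> (\<forall>z\<in>mspace M. mdist M x z < r \<longrightarrow> z \<in> S)" if "x \<in> mspace M" for x r
    using that by auto
  then show ?thesis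
    unfolding mtopology_of_def openin_mtopology by (meson subsetD)
qed

text \<open>Balls of radius \<open>r/2\<close> in the factors fit into a ball of radius
  \<open>r\<close> for the sum, and a ball of radius \<open>min r s\<close> fits into a box. With
  this identification the tube lemma and the openness of boxes become available for the sum
  metric.\<close>

lemma mtopology_of_sum_metric:
  "mtopology_of (sum_metric M N) = prod_topology (mtopology_of M) (mtopology_of N)"
proof (rule topology_eq[THEN iffD2], rule allI)
  fix S
  show "openin (mtopology_of (sum_metric M N)) S \<longleftrightarrow>
        openin (prod_topology (mtopology_of M) (mtopology_of N)) S"
  proof
    assume S: "openin (mtopology_of (sum_metric M N)) S"
    show "openin (prod_topology (mtopology_of M) (mtopology_of N)) S"
      unfolding openin_prod_topology_alt
    proof (intro allI impI)
      fix x y assume xy: "(x, y) \<in> S"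
      with S obtain r where r: "r > 0"
        and rS: "\<And>z. z \<in> mspace M \<times> mspace N \<Longrightarrow>
                   mdist M x (fst z) + mdist N y (snd z) < r \<Longrightarrow> z \<in> S"
        unfolding openin_mtopology_of by fastforce
      have x: "x \<in> mspace M" and y: "y \<in> mspace N"
        using S xy openin_mtopology_of_subset by fastforce+
      have "openin (mtopology_of M) (mball_of M x (r/2))" "openin (mtopology_of N) (mball_of N y (r/2))"
        by (simp_all add: mtopology_of_def mball_of_def Metric_space.openin_mball)
      moreover have zero: "mdist M x x = 0" "mdist N y y = 0"
        using x y by simp_all
      have "x \<in> mball_of M x (r/2)" "y \<in> mball_of N y (r/2)"
        using x y r by (simp_all add: in_mball_of zero)
      moreover have "mball_of M x (r/2) \<times> mball_of N y (r/2) \<subseteq> S"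
        by (intro subsetI rS) (auto simp: in_mball_of)
      ultimately show "\<exists>U V. openin (mtopology_of M) U \<and> openin (mtopology_of N) V \<and>
                         x \<in> U \<and> y \<in> V \<and> U \<times> V \<subseteq> S"
        by blast
    qed
  next
    assume S: "openin (prod_topology (mtopology_of M) (mtopology_of N)) S"
    show "openin (mtopology_of (sum_metric M N)) S"
      unfolding openin_mtopology_of
    proof (intro conjI ballI)
      show "S \<subseteq> mspace (sum_metric M N)"
        using openin_subset[OF S] by simp
      fix w assume "w \<in> S"
      then obtain x y where w: "w = (x, y)" "(x, y) \<in> S"
        by (cases w) auto
      with S obtain P Q where PQ: "openin (mtopology_of M) P" "openin (mtopology_of N) Q"
        "x \<in> P" "y \<in> Q" "P \<times> Q \<subseteq> S"
        unfolding openin_prod_topology_alt by meson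
      then obtain r s where "r > 0" "\<And>z. z \<in> mspace M \<Longrightarrow> mdist M x z < r \<Longrightarrow> z \<in> P"
        "s > 0" "\<And>z. z \<in> mspace N \<Longrightarrow> mdist N y z < s \<Longrightarrow> z \<in> Q"
        unfolding openin_mtopology_of by meson
      moreover have "mdist M x a < r \<and> mdist N y b < s"
        if "mdist M x a + mdist N y b < min r s" for a b
        using that mdist_nonneg[of M x a] mdist_nonneg[of N y b] by linarith
      ultimately show "\<exists>r>0. \<forall>z\<in>mspace (sum_metric M N).
                         mdist (sum_metric M N) w z < r \<longrightarrow> z \<in> S"
        using PQ(5) w(1) by (intro exI[of _ "min r s"]) (auto simp: subset_iff)
    qed
  qed
qed

lemma metric_eqI:
  assumes "mspace M = mspace N" "mdist M = mdist N"
  shows "M = N"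
  using assms by (simp add: mspace_def mdist_def prod_eq_iff flip: dest_metric_inject)

text \<open>Literal equality holds because passing to a submetric changes the point set but keeps
  the total distance function. Products and restrictions can therefore be exchanged by
  rewriting.\<close>

lemma submetric_sum_metric:
  "submetric (sum_metric M N) (S \<times> T) = sum_metric (submetric M S) (submetric N T)"
  by (rule metric_eqI) (auto simp: fun_eq_iff)

lemma mspace_submetric_subset [simp]: "S \<subseteq> mspace M \<Longrightarrow> mspace (submetric M S) = S"
  by auto

lemma openin_sum_metric_Times:
  "openin (mtopology_of M) S \<Longrightarrow> openin (mtopology_of N) T \<Longrightarrow>
     openin (mtopology_of (sum_metric M N)) (S \<times> T)"
  by (simp add: mtopology_of_sum_metric openin_prod_Times_iff)

lemma openin_mspace [simp]: "openin (mtopology_of M) (mspace M)"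
  by (metis openin_topspace topspace_mtopology_of)

lemma openin_submetric_whole:
  assumes "S \<subseteq> mspace M"
  shows "openin (mtopology_of (submetric M S)) S"
  using openin_mspace[of "submetric M S"] unfolding mspace_submetric_subset[OF assms] .

lemma Hausdorff_space_mtopology_of [simp]: "Hausdorff_space (mtopology_of M)"
  by (simp add: mtopology_of_def Metric_space.Hausdorff_space_mtopology)

subsection \<open>Open Lipschitz embeddings\<close>

text \<open>One open set and one constant serve both the map and its inverse, which avoids speaking
  of \<open>inv_into\<close>. The sign of \<open>L\<close> is recorded so that estimates can be
  multiplied in a composition.\<close>

definition locally_bilipschitz :: "'a metric \<Rightarrow> 'b metric \<Rightarrow> ('a \<Rightarrow> 'b) \<Rightarrow> bool" where
  "locally_bilipschitz M N f \<longleftrightarrow>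
     (\<forall>x\<in>mspace M. \<exists>Q L. openin (mtopology_of M) Q \<and> x \<in> Q \<and> 0 \<le> L \<and>
        (\<forall>u\<in>Q. \<forall>v\<in>Q. mdist N (f u) (f v) \<le> L * mdist M u v \<and>
                       mdist M u v \<le> L * mdist N (f u) (f v)))"

lemma lipschitz_map_imp_continuous_map:
  assumes "lipschitz_map M N f"
  shows "continuous_map (mtopology_of M) (mtopology_of N) f"
  unfolding continuous_map
proof (intro conjI allI impI)
  show "f ` topspace (mtopology_of M) \<subseteq> topspace (mtopology_of N)"
    using assms by (auto simp: lipschitz_map_def)
  fix T assume T: "openin (mtopology_of N) T"
  show "openin (mtopology_of M) {x \<in> topspace (mtopology_of M). f x \<in> T}"
  proof (subst openin_subopen, clarsimp)
    fix x assume x: "x \<in> mspace M" "f x \<in> T"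
    then obtain Q where Q: "openin (mtopology_of M) Q" "x \<in> Q"
      "Lipschitz_continuous_map (submetric M Q) N f"
      using assms by (auto simp: lipschitz_map_def)
    then have "continuous_map (mtopology_of (submetric M Q)) (mtopology_of N) f"
      using Lipschitz_continuous_imp_continuous_map by blast
    then have "openin (mtopology_of (submetric M Q)) {z \<in> topspace (mtopology_of (submetric M Q)). f z \<in> T}"
      using T by (rule openin_continuous_map_preimage)
    moreover have "{z \<in> topspace (mtopology_of (submetric M Q)). f z \<in> T} = {z \<in> Q. f z \<in> T}"
      using openin_mtopology_of_subset[OF Q(1)] by auto
    ultimately have "openin (mtopology_of M) {z \<in> Q. f z \<in> T}"
      using Q(1) unfolding mtopology_of_submetric openin_open_subtopology[OF Q(1)] by metis
    with x Q(2) show "\<exists>T'. openin (mtopology_of M) T' \<and> x \<in> T' \<and> T' \<subseteq> {x \<in> mspace M. f x \<in> T}"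
      using openin_mtopology_of_subset[OF Q(1)] by (intro exI[of _ "{z \<in> Q. f z \<in> T}"]) auto
  qed
qed

lemma lipschitz_mapE:
  assumes "lipschitz_map M N f" "x \<in> mspace M"
  obtains Q L where "openin (mtopology_of M) Q" "x \<in> Q"
    "\<And>u v. u \<in> Q \<Longrightarrow> v \<in> Q \<Longrightarrow> mdist N (f u) (f v) \<le> L * mdist M u v"
proof -
  obtain Q where Q: "openin (mtopology_of M) Q" "x \<in> Q"
    and "Lipschitz_continuous_map (submetric M Q) N f"
    using assms unfolding lipschitz_map_def by blast
  then obtain L where "\<forall>u\<in>Q \<inter> mspace M. \<forall>v\<in>Q \<inter> mspace M. mdist N (f u) (f v) \<le> L * mdist M u v"
    unfolding Lipschitz_continuous_map_def by auto
  then show thesis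
    using openin_mtopology_of_subset[OF Q(1)] by (intro that[OF Q]) blast
qed

lemma lipschitz_mapI:
  assumes "f \<in> mspace M \<rightarrow> mspace N"
    and "\<And>x. x \<in> mspace M \<Longrightarrow> \<exists>Q L. openin (mtopology_of M) Q \<and> x \<in> Q \<and>
           (\<forall>u\<in>Q. \<forall>v\<in>Q. mdist N (f u) (f v) \<le> L * mdist M u v)"
  shows "lipschitz_map M N f"
  unfolding lipschitz_map_def
proof (intro conjI ballI assms(1))
  fix x assume "x \<in> mspace M"
  then obtain Q L where Q: "openin (mtopology_of M) Q" "x \<in> Q"
    and "\<forall>u\<in>Q. \<forall>v\<in>Q. mdist N (f u) (f v) \<le> L * mdist M u v"
    using assms(2) by blast
  then have "Lipschitz_continuous_map (submetric M Q) N f"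
    using assms(1) unfolding Lipschitz_continuous_map_def mspace_submetric mdist_submetric by blast
  with Q show "\<exists>Q. openin (mtopology_of M) Q \<and> x \<in> Q \<and> Lipschitz_continuous_map (submetric M Q) N f"
    by blast
qed

text \<open>A Lipschitz bound for the inverse near \<open>f x\<close> amounts to a lower bound for
  \<open>f\<close> near \<open>x\<close>: continuity of \<open>f\<close> pulls neighbourhoods in the
  image back, and openness of \<open>f\<close> pushes neighbourhoods of \<open>x\<close>
  forward.\<close>

lemma open_lipschitz_embedding_iff:
  "open_lipschitz_embedding M N f \<longleftrightarrow>
     f \<in> mspace M \<rightarrow> mspace N \<and> inj_on f (mspace M) \<and>
     open_map (mtopology_of M) (mtopology_of N) f \<and> locally_bilipschitz M N f"
  (is "?lhs \<longleftrightarrow> ?rhs")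
proof
  assume L: ?lhs
  let ?g = "inv_into (mspace M) f" and ?I = "submetric N (f ` mspace M)"
  have maps: "f \<in> mspace M \<rightarrow> mspace N" and inj: "inj_on f (mspace M)"
    and f: "lipschitz_map M ?I f" and g: "lipschitz_map ?I M ?g"
    using L by (auto simp: open_lipschitz_embedding_def lipschitz_embedding_def)
  have "locally_bilipschitz M N f"
    unfolding locally_bilipschitz_def
  proof
    fix x assume x: "x \<in> mspace M"
    have fx: "f x \<in> mspace ?I"
      using x maps by auto
    obtain Q K where Q: "openin (mtopology_of M) Q" "x \<in> Q"
      and K: "\<And>u v. u \<in> Q \<Longrightarrow> v \<in> Q \<Longrightarrow> mdist ?I (f u) (f v) \<le> K * mdist M u v"
      using lipschitz_mapE[OF f x] by blast
    obtain P J where P: "openin (mtopology_of ?I) P" "f x \<in> P"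
      and J: "\<And>u v. u \<in> P \<Longrightarrow> v \<in> P \<Longrightarrow> mdist M (?g u) (?g v) \<le> J * mdist ?I u v"
      using lipschitz_mapE[OF g fx] by blast
    \<comment> \<open>The part of \<open>Q\<close> mapped into \<open>P\<close> is open and carries
      both estimates. Absolute values are taken because \<open>K\<close> and \<open>J\<close> come
      without a sign.\<close>
    let ?O = "{z \<in> Q. f z \<in> P}" and ?L = "max \<bar>K\<bar> \<bar>J\<bar>"
    have "openin (mtopology_of M) ?O"
      using openin_continuous_map_preimage_gen[OF lipschitz_map_imp_continuous_map[OF f] Q(1) P(1)] .
    moreover have "mdist N (f u) (f v) \<le> ?L * mdist M u v \<and> mdist M u v \<le> ?L * mdist N (f u) (f v)"
      if "u \<in> ?O" "v \<in> ?O" for u v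
    proof
      have "mdist N (f u) (f v) \<le> K * mdist M u v"
        using that K by auto
      also have "\<dots> \<le> ?L * mdist M u v"
        by (intro mult_right_mono) auto
      finally show "mdist N (f u) (f v) \<le> ?L * mdist M u v" .
      have "u \<in> mspace M" "v \<in> mspace M"
        using that Q(1) openin_mtopology_of_subset by auto
      then have "mdist M u v \<le> J * mdist N (f u) (f v)"
        using J[of "f u" "f v"] that inj by simp
      also have "\<dots> \<le> ?L * mdist N (f u) (f v)"
        by (intro mult_right_mono) auto
      finally show "mdist M u v \<le> ?L * mdist N (f u) (f v)" .
    qed
    ultimately show "\<exists>Q L. openin (mtopology_of M) Q \<and> x \<in> Q \<and> 0 \<le> L \<and>
        (\<forall>u\<in>Q. \<forall>v\<in>Q. mdist N (f u) (f v) \<le> L * mdist M u v \<and>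
                       mdist M u v \<le> L * mdist N (f u) (f v))"
      using Q(2) P(2) by (intro exI[of _ ?O] exI[of _ ?L]) auto
  qed
  with L maps inj show ?rhs
    by (simp add: open_lipschitz_embedding_def)
next
  assume R: ?rhs
  let ?g = "inv_into (mspace M) f" and ?I = "submetric N (f ` mspace M)"
  have maps: "f \<in> mspace M \<rightarrow> mspace N" and inj: "inj_on f (mspace M)"
    and op: "open_map (mtopology_of M) (mtopology_of N) f"
    using R by auto
  have bl: "\<exists>Q L. openin (mtopology_of M) Q \<and> x \<in> Q \<and>
        (\<forall>u\<in>Q. \<forall>v\<in>Q. mdist N (f u) (f v) \<le> L * mdist M u v \<and>
                       mdist M u v \<le> L * mdist N (f u) (f v))" if "x \<in> mspace M" for x
    using R that unfolding locally_bilipschitz_def by meson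
  have "lipschitz_map M ?I f"
  proof (rule lipschitz_mapI)
    show "f \<in> mspace M \<rightarrow> mspace ?I"
      using maps by auto
    fix x assume "x \<in> mspace M"
    then show "\<exists>Q L. openin (mtopology_of M) Q \<and> x \<in> Q \<and>
           (\<forall>u\<in>Q. \<forall>v\<in>Q. mdist ?I (f u) (f v) \<le> L * mdist M u v)"
      using bl unfolding mdist_submetric by meson
  qed
  moreover have "lipschitz_map ?I M ?g"
  proof (rule lipschitz_mapI)
    show "?g \<in> mspace ?I \<rightarrow> mspace M"
      by (simp add: Pi_iff inv_into_into)
    fix y assume "y \<in> mspace ?I"
    then obtain x where x: "x \<in> mspace M" "y = f x"
      by auto
    then obtain Q L where Q: "openin (mtopology_of M) Q" "x \<in> Q"
      and L: "\<forall>u\<in>Q. \<forall>v\<in>Q. mdist N (f u) (f v) \<le> L * mdist M u v \<and>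
                       mdist M u v \<le> L * mdist N (f u) (f v)"
      using bl by blast
    have QM: "Q \<subseteq> mspace M"
      using Q(1) by (rule openin_mtopology_of_subset)
    have "openin (mtopology_of N) (f ` Q)"
      using op Q(1) by (simp add: open_map_def)
    then have "openin (mtopology_of ?I) (f ` Q)"
      using QM unfolding mtopology_of_submetric openin_subtopology by blast
    moreover have "mdist M (?g u) (?g v) \<le> L * mdist ?I u v" if "u \<in> f ` Q" "v \<in> f ` Q" for u v
    proof -
      from that obtain u' v' where "u' \<in> Q" "v' \<in> Q" "u = f u'" "v = f v'"
        by blast
      with L QM inj show ?thesis
        by (simp add: subset_iff)
    qed
    ultimately show "\<exists>P L. openin (mtopology_of ?I) P \<and> y \<in> P \<and>
        (\<forall>u\<in>P. \<forall>v\<in>P. mdist M (?g u) (?g v) \<le> L * mdist ?I u v)"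
      using x Q(2) by blast
  qed
  ultimately show ?lhs
    using maps inj op by (simp add: open_lipschitz_embedding_def lipschitz_embedding_def)
qed

lemma open_lipschitz_embedding_bilipschitzE:
  assumes "open_lipschitz_embedding M N f" "x \<in> mspace M"
  obtains Q L where "openin (mtopology_of M) Q" "x \<in> Q" "0 \<le> L"
    "\<And>u v. u \<in> Q \<Longrightarrow> v \<in> Q \<Longrightarrow> mdist N (f u) (f v) \<le> L * mdist M u v \<and>
       mdist M u v \<le> L * mdist N (f u) (f v)"
  using assms unfolding open_lipschitz_embedding_iff locally_bilipschitz_def by meson

lemma open_lipschitz_embedding_imp_continuous_map:
  assumes "open_lipschitz_embedding M N f"
  shows "continuous_map (mtopology_of M) (mtopology_of N) f"
proof -
  have "continuous_map (mtopology_of M) (mtopology_of (submetric N (f ` mspace M))) f"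
    using assms lipschitz_map_imp_continuous_map
    unfolding open_lipschitz_embedding_def lipschitz_embedding_def by blast
  then show ?thesis
    by (simp add: mtopology_of_submetric continuous_map_in_subtopology)
qed

lemma open_lipschitz_embedding_openin_image:
  assumes "open_lipschitz_embedding M N f"
  shows "openin (mtopology_of N) (f ` mspace M)"
  using assms unfolding open_lipschitz_embedding_def open_map_def
  by (metis openin_topspace topspace_mtopology_of)

section \<open>Stability of open Lipschitz embeddings under the basic operations\<close>

text \<open>Maps are total functions, so a composite of charts, inverses and swaps matches the
  intended formula only on its domain. This transfers the property from the composite to the
  formula.\<close>

lemma open_lipschitz_embedding_cong:
  assumes f: "open_lipschitz_embedding M N f" and eq: "\<And>x. x \<in> mspace M \<Longrightarrow> f x = g x"
  shows "open_lipschitz_embedding M N g"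
  unfolding open_lipschitz_embedding_iff
proof (intro conjI)
  show "g \<in> mspace M \<rightarrow> mspace N" "inj_on g (mspace M)"
    using f eq by (auto simp: open_lipschitz_embedding_iff Pi_iff inj_on_def)
  have "g ` Q = f ` Q" if "openin (mtopology_of M) Q" for Q
    using eq openin_mtopology_of_subset[OF that] by (intro image_cong) auto
  then show "open_map (mtopology_of M) (mtopology_of N) g"
    using f by (simp add: open_lipschitz_embedding_def open_map_def)
  show "locally_bilipschitz M N g"
    unfolding locally_bilipschitz_def
  proof
    fix x assume "x \<in> mspace M"
    then obtain Q L where Q: "openin (mtopology_of M) Q" "x \<in> Q" "0 \<le> L"
      "\<And>u v. u \<in> Q \<Longrightarrow> v \<in> Q \<Longrightarrow> mdist N (f u) (f v) \<le> L * mdist M u v \<and>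
           mdist M u v \<le> L * mdist N (f u) (f v)"
      using f unfolding open_lipschitz_embedding_iff locally_bilipschitz_def by meson
    moreover have "f u = g u" if "u \<in> Q" for u
      using that eq openin_mtopology_of_subset[OF Q(1)] by blast
    ultimately show "\<exists>Q L. openin (mtopology_of M) Q \<and> x \<in> Q \<and> 0 \<le> L \<and>
        (\<forall>u\<in>Q. \<forall>v\<in>Q. mdist N (g u) (g v) \<le> L * mdist M u v \<and>
                       mdist M u v \<le> L * mdist N (g u) (g v))"
      by (intro exI[of _ Q] exI[of _ L]) auto
  qed
qed

lemma open_lipschitz_embedding_compose:
  assumes "open_lipschitz_embedding M N f" "open_lipschitz_embedding N P g"
  shows "open_lipschitz_embedding M P (g \<circ> f)"
  unfolding open_lipschitz_embedding_iff
proof (intro conjI)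
  have f: "f \<in> mspace M \<rightarrow> mspace N" "inj_on f (mspace M)"
    and g: "g \<in> mspace N \<rightarrow> mspace P" "inj_on g (mspace N)"
    using assms by (auto simp: open_lipschitz_embedding_iff)
  then show "g \<circ> f \<in> mspace M \<rightarrow> mspace P" "inj_on (g \<circ> f) (mspace M)"
    by (auto simp: Pi_iff inj_on_def)
  show "open_map (mtopology_of M) (mtopology_of P) (g \<circ> f)"
    using assms unfolding open_lipschitz_embedding_def by (blast intro: open_map_compose)
  show "locally_bilipschitz M P (g \<circ> f)"
    unfolding locally_bilipschitz_def
  proof
    fix x assume x: "x \<in> mspace M"
    then have fx: "f x \<in> mspace N"
      using f by auto
    obtain Q K where Q: "openin (mtopology_of M) Q" "x \<in> Q" "0 \<le> K"
      and K: "\<And>u v. u \<in> Q \<Longrightarrow> v \<in> Q \<Longrightarrow> mdist N (f u) (f v) \<le> K * mdist M u v \<and>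
                mdist M u v \<le> K * mdist N (f u) (f v)"
      using assms(1) x unfolding open_lipschitz_embedding_iff locally_bilipschitz_def by meson
    obtain R J where R: "openin (mtopology_of N) R" "f x \<in> R" "0 \<le> J"
      and J: "\<And>u v. u \<in> R \<Longrightarrow> v \<in> R \<Longrightarrow> mdist P (g u) (g v) \<le> J * mdist N u v \<and>
                mdist N u v \<le> J * mdist P (g u) (g v)"
      using assms(2) fx unfolding open_lipschitz_embedding_iff locally_bilipschitz_def by meson
    let ?O = "{z \<in> Q. f z \<in> R}"
    have "openin (mtopology_of M) ?O"
      using open_lipschitz_embedding_imp_continuous_map[OF assms(1)] Q(1) R(1)
      by (rule openin_continuous_map_preimage_gen)
    moreover have "mdist P (g (f u)) (g (f v)) \<le> (K * J) * mdist M u v \<and>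
        mdist M u v \<le> (K * J) * mdist P (g (f u)) (g (f v))" if "u \<in> ?O" "v \<in> ?O" for u v
    proof
      have "J * mdist N (f u) (f v) \<le> J * (K * mdist M u v)"
        using K[of u v] that R(3) by (intro mult_left_mono) auto
      then show "mdist P (g (f u)) (g (f v)) \<le> (K * J) * mdist M u v"
        using J[of "f u" "f v"] that by (simp add: ac_simps)
      have "K * mdist N (f u) (f v) \<le> K * (J * mdist P (g (f u)) (g (f v)))"
        using J[of "f u" "f v"] that Q(3) by (intro mult_left_mono) auto
      then show "mdist M u v \<le> (K * J) * mdist P (g (f u)) (g (f v))"
        using K[of u v] that by (simp add: ac_simps)
    qed
    ultimately show "\<exists>Q L. openin (mtopology_of M) Q \<and> x \<in> Q \<and> 0 \<le> L \<and>
        (\<forall>u\<in>Q. \<forall>v\<in>Q. mdist P ((g \<circ> f) u) ((g \<circ> f) v) \<le> L * mdist M u v \<and>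
                       mdist M u v \<le> L * mdist P ((g \<circ> f) u) ((g \<circ> f) v))"
      using Q R by (intro exI[of _ ?O] exI[of _ "K * J"]) auto
  qed
qed

lemma open_lipschitz_embedding_restrict:
  assumes "open_lipschitz_embedding M N f" "openin (mtopology_of M) S"
  shows "open_lipschitz_embedding (submetric M S) N f"
  unfolding open_lipschitz_embedding_iff
proof (intro conjI)
  show "f \<in> mspace (submetric M S) \<rightarrow> mspace N" "inj_on f (mspace (submetric M S))"
    using assms by (auto simp: open_lipschitz_embedding_iff inj_on_def)
  show "open_map (mtopology_of (submetric M S)) (mtopology_of N) f"
    using assms open_map_from_subtopology
    by (simp add: open_lipschitz_embedding_def mtopology_of_submetric open_map_from_subtopology)
  show "locally_bilipschitz (submetric M S) N f"
    unfolding locally_bilipschitz_def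
  proof
    fix x assume "x \<in> mspace (submetric M S)"
    then have "x \<in> mspace M" "x \<in> S"
      by auto
    then obtain Q K where Q: "openin (mtopology_of M) Q" "x \<in> Q" "0 \<le> K"
      and K: "\<And>u v. u \<in> Q \<Longrightarrow> v \<in> Q \<Longrightarrow> mdist N (f u) (f v) \<le> K * mdist M u v \<and>
                mdist M u v \<le> K * mdist N (f u) (f v)"
      using assms(1) unfolding open_lipschitz_embedding_iff locally_bilipschitz_def by meson
    then show "\<exists>Q L. openin (mtopology_of (submetric M S)) Q \<and> x \<in> Q \<and> 0 \<le> L \<and>
        (\<forall>u\<in>Q. \<forall>v\<in>Q. mdist N (f u) (f v) \<le> L * mdist (submetric M S) u v \<and>
                       mdist (submetric M S) u v \<le> L * mdist N (f u) (f v))"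
      using \<open>x \<in> S\<close> assms(2)
      by (intro exI[of _ "Q \<inter> S"] exI[of _ K])
         (auto simp: mtopology_of_submetric openin_open_subtopology)
  qed
qed

lemma open_lipschitz_embedding_into_submetric:
  assumes "open_lipschitz_embedding M N f" "f ` mspace M \<subseteq> S"
  shows "open_lipschitz_embedding M (submetric N S) f"
proof -
  have "open_map (mtopology_of M) (mtopology_of (submetric N S)) f"
    using assms unfolding mtopology_of_submetric open_lipschitz_embedding_def
    by (intro open_map_into_subtopology) auto
  moreover have "f \<in> mspace M \<rightarrow> mspace (submetric N S)"
    using assms by (auto simp: open_lipschitz_embedding_iff)
  ultimately show ?thesis
    using assms(1) unfolding open_lipschitz_embedding_iff locally_bilipschitz_def mdist_submetric
    by blast
qed

text \<open>Openness of \<open>S\<close> is what turns images that are relatively open in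
  \<open>S\<close> into sets open in \<open>N\<close>.\<close>

lemma open_lipschitz_embedding_from_submetric:
  assumes "open_lipschitz_embedding M (submetric N S) f" "openin (mtopology_of N) S"
  shows "open_lipschitz_embedding M N f"
proof -
  have "open_map (mtopology_of M) (mtopology_of N) f"
    using assms unfolding mtopology_of_submetric open_lipschitz_embedding_def open_map_def
    by (simp add: openin_open_subtopology)
  moreover have "f \<in> mspace M \<rightarrow> mspace N"
    using assms by (auto simp: open_lipschitz_embedding_iff)
  ultimately show ?thesis
    using assms(1) unfolding open_lipschitz_embedding_iff locally_bilipschitz_def mdist_submetric
    by blast
qed

text \<open>The two-sided estimate is symmetric in a map and its inverse, so it can be read on the
  image of \<open>Q\<close>. Openness of the inverse is continuity of \<open>f\<close>.\<close>

lemma open_lipschitz_embedding_inv_into: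
  assumes "open_lipschitz_embedding M N f"
  shows "open_lipschitz_embedding (submetric N (f ` mspace M)) M (inv_into (mspace M) f)"
  unfolding open_lipschitz_embedding_iff
proof (intro conjI)
  let ?g = "inv_into (mspace M) f" and ?I = "submetric N (f ` mspace M)"
  have maps: "f \<in> mspace M \<rightarrow> mspace N" and inj: "inj_on f (mspace M)"
    and op: "open_map (mtopology_of M) (mtopology_of N) f"
    using assms by (auto simp: open_lipschitz_embedding_iff)
  show "?g \<in> mspace ?I \<rightarrow> mspace M"
    by (simp add: Pi_iff inv_into_into)
  show "inj_on ?g (mspace ?I)"
    by (simp add: inj_on_inv_into)
  show "open_map (mtopology_of ?I) (mtopology_of M) ?g"
    unfolding open_map_def
  proof (intro allI impI)
    fix T assume T: "openin (mtopology_of ?I) T"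
    then have "T \<subseteq> f ` mspace M" "openin (mtopology_of N) T"
      using openin_mtopology_of_subset[OF T] open_lipschitz_embedding_openin_image[OF assms]
      by (auto simp: mtopology_of_submetric openin_open_subtopology)
    moreover from this have "?g ` T = {x \<in> topspace (mtopology_of M). f x \<in> T}"
    proof (intro equalityI subsetI)
      fix x assume "x \<in> ?g ` T"
      with \<open>T \<subseteq> f ` mspace M\<close> show "x \<in> {x \<in> topspace (mtopology_of M). f x \<in> T}"
        by (auto simp: inv_into_into f_inv_into_f)
    next
      fix x assume "x \<in> {x \<in> topspace (mtopology_of M). f x \<in> T}"
      then have "x = ?g (f x)" "f x \<in> T"
        using inj by simp_all
      then show "x \<in> ?g ` T"
        by (rule image_eqI)
    qed
    ultimately show "openin (mtopology_of M) (?g ` T)"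
      using openin_continuous_map_preimage[OF open_lipschitz_embedding_imp_continuous_map[OF assms]]
      by metis
  qed
  show "locally_bilipschitz ?I M ?g"
    unfolding locally_bilipschitz_def
  proof
    fix y assume "y \<in> mspace ?I"
    then obtain x where x: "x \<in> mspace M" "y = f x"
      by auto
    then obtain Q L where Q: "openin (mtopology_of M) Q" "x \<in> Q" "0 \<le> L"
      and L: "\<And>u v. u \<in> Q \<Longrightarrow> v \<in> Q \<Longrightarrow> mdist N (f u) (f v) \<le> L * mdist M u v \<and>
           mdist M u v \<le> L * mdist N (f u) (f v)"
      using assms unfolding open_lipschitz_embedding_iff locally_bilipschitz_def by meson
    have QM: "Q \<subseteq> mspace M"
      using Q(1) by (rule openin_mtopology_of_subset)
    have "openin (mtopology_of N) (f ` Q)"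
      using op Q(1) by (simp add: open_map_def)
    then have "openin (mtopology_of ?I) (f ` Q)"
      using QM unfolding mtopology_of_submetric openin_subtopology by blast
    moreover have "mdist M (?g u) (?g v) \<le> L * mdist ?I u v \<and> mdist ?I u v \<le> L * mdist M (?g u) (?g v)"
      if "u \<in> f ` Q" "v \<in> f ` Q" for u v
    proof -
      from that obtain u' v' where "u' \<in> Q" "v' \<in> Q" "u = f u'" "v = f v'"
        by blast
      with L QM inj show ?thesis
        by (simp add: subset_iff)
    qed
    ultimately show "\<exists>Q L. openin (mtopology_of ?I) Q \<and> y \<in> Q \<and> 0 \<le> L \<and>
        (\<forall>u\<in>Q. \<forall>v\<in>Q. mdist M (?g u) (?g v) \<le> L * mdist ?I u v \<and>
                       mdist ?I u v \<le> L * mdist M (?g u) (?g v))"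
      using x Q(2,3) by blast
  qed
qed

text \<open>Charts take the fiber variable first and isotopies the parameter first; the swap, an
  isometry for the sum metrics, converts between the two conventions.\<close>

lemma open_lipschitz_embedding_swap:
  "open_lipschitz_embedding (sum_metric M N) (sum_metric N M) prod.swap"
  unfolding open_lipschitz_embedding_iff
proof (intro conjI)
  show "open_map (mtopology_of (sum_metric M N)) (mtopology_of (sum_metric N M)) prod.swap"
    using homeomorphic_imp_open_map[OF homeomorphic_map_swap, of "mtopology_of M" "mtopology_of N"]
    by (simp add: mtopology_of_sum_metric case_prod_unfold flip: prod.swap_def)
  show "locally_bilipschitz (sum_metric M N) (sum_metric N M) prod.swap"
    unfolding locally_bilipschitz_def
  proof
    fix x assume "x \<in> mspace (sum_metric M N)"
    moreover have "openin (mtopology_of (sum_metric M N)) (mspace (sum_metric M N))"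
      by (metis openin_topspace topspace_mtopology_of)
    ultimately show "\<exists>Q L. openin (mtopology_of (sum_metric M N)) Q \<and> x \<in> Q \<and> 0 \<le> L \<and>
        (\<forall>u\<in>Q. \<forall>v\<in>Q. mdist (sum_metric N M) (prod.swap u) (prod.swap v) \<le> L * mdist (sum_metric M N) u v \<and>
           mdist (sum_metric M N) u v \<le> L * mdist (sum_metric N M) (prod.swap u) (prod.swap v))"
      by (intro exI[of _ "mspace (sum_metric M N)"] exI[of _ 1]) (simp add: add.commute)
  qed
qed auto

text \<open>Openness and the two-sided estimate are local and are inherited from the cover; only
  injectivity is global and has to be supplied. This assembles the final chart from two
  pieces.\<close>

lemma open_lipschitz_embedding_glue:
  assumes inj: "inj_on f (mspace M)"
    and cover: "\<And>x. x \<in> mspace M \<Longrightarrow> \<exists>S. openin (mtopology_of M) S \<and> x \<in> S \<and>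
                  open_lipschitz_embedding (submetric M S) N f"
  shows "open_lipschitz_embedding M N f"
  unfolding open_lipschitz_embedding_iff
proof (intro conjI)
  show "f \<in> mspace M \<rightarrow> mspace N"
  proof
    fix x assume "x \<in> mspace M"
    then obtain S where "x \<in> S" "open_lipschitz_embedding (submetric M S) N f"
      using cover by blast
    with \<open>x \<in> mspace M\<close> show "f x \<in> mspace N"
      unfolding open_lipschitz_embedding_iff by auto
  qed
  show "open_map (mtopology_of M) (mtopology_of N) f"
    unfolding open_map_def
  proof (intro allI impI)
    fix Q assume Q: "openin (mtopology_of M) Q"
    show "openin (mtopology_of N) (f ` Q)"
    proof (subst openin_subopen, rule ballI)
      fix y assume "y \<in> f ` Q"
      then obtain x where x: "x \<in> Q" "y = f x"
        by auto
      then obtain S where S: "openin (mtopology_of M) S" "x \<in> S"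
        "open_lipschitz_embedding (submetric M S) N f"
        using cover openin_mtopology_of_subset[OF Q] by blast
      have "openin (mtopology_of (submetric M S)) (Q \<inter> S)"
        using Q S by (auto simp: mtopology_of_submetric openin_open_subtopology)
      then have "openin (mtopology_of N) (f ` (Q \<inter> S))"
        using S(3) by (simp add: open_lipschitz_embedding_def open_map_def)
      with x S(2) show "\<exists>T. openin (mtopology_of N) T \<and> y \<in> T \<and> T \<subseteq> f ` Q"
        by blast
    qed
  qed
  show "locally_bilipschitz M N f"
    unfolding locally_bilipschitz_def
  proof
    fix x assume "x \<in> mspace M"
    then obtain S where S: "openin (mtopology_of M) S" "x \<in> S"
      "open_lipschitz_embedding (submetric M S) N f"
      using cover by blast
    moreover have "x \<in> mspace (submetric M S)"
      using \<open>x \<in> mspace M\<close> \<open>x \<in> S\<close> by auto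
    ultimately obtain Q L where Q: "openin (mtopology_of (submetric M S)) Q" "x \<in> Q" "0 \<le> L"
      "\<forall>u\<in>Q. \<forall>v\<in>Q. mdist N (f u) (f v) \<le> L * mdist M u v \<and> mdist M u v \<le> L * mdist N (f u) (f v)"
      unfolding open_lipschitz_embedding_iff locally_bilipschitz_def mdist_submetric by meson
    moreover have "openin (mtopology_of M) Q"
      using Q(1) S(1) by (simp add: mtopology_of_submetric openin_open_subtopology)
    ultimately show "\<exists>Q L. openin (mtopology_of M) Q \<and> x \<in> Q \<and> 0 \<le> L \<and>
        (\<forall>u\<in>Q. \<forall>v\<in>Q. mdist N (f u) (f v) \<le> L * mdist M u v \<and>
                       mdist M u v \<le> L * mdist N (f u) (f v))"
      by blast
  qed
qed (rule inj)

lemma open_lipschitz_embedding_submetric_mono: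
  assumes "open_lipschitz_embedding (submetric M S) N f" "openin (mtopology_of M) T" "T \<subseteq> S"
  shows "open_lipschitz_embedding (submetric M T) N f"
proof -
  have "openin (mtopology_of (submetric M S)) T"
    using assms(2,3) by (auto simp: mtopology_of_submetric openin_subtopology)
  from open_lipschitz_embedding_restrict[OF assms(1) this] show ?thesis
    using assms(3) by (simp add: Int_absorb1)
qed

subsection \<open>Lipschitz isotopies\<close>

lemma lipschitz_isotopy_cong:
  assumes "lipschitz_isotopy Z U Y h"
    and "\<And>t x. t \<in> mspace Z \<Longrightarrow> x \<in> mspace U \<Longrightarrow> h t x = k t x"
  shows "lipschitz_isotopy Z U Y k"
  using assms(1) unfolding lipschitz_isotopy_def
  by (rule open_lipschitz_embedding_cong) (use assms(2) in auto)

text \<open>The total map preserves the parameter, so restricting the parameters in the source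
  restricts them in the target to the same set.\<close>

lemma lipschitz_isotopy_restrict:
  assumes h: "lipschitz_isotopy Z U Y h" and N: "openin (mtopology_of Z) N"
  shows "lipschitz_isotopy (submetric Z N) U Y h"
proof -
  have NZ: "N \<subseteq> mspace Z"
    using N by (rule openin_mtopology_of_subset)
  have dom: "submetric (sum_metric Z U) (N \<times> mspace U) = sum_metric (submetric Z N) U"
    and cod: "submetric (sum_metric Z Y) (N \<times> mspace Y) = sum_metric (submetric Z N) Y"
    by (simp_all add: submetric_sum_metric)
  have "openin (mtopology_of (sum_metric Z U)) (N \<times> mspace U)"
    using N by (intro openin_sum_metric_Times openin_mspace)
  then have "open_lipschitz_embedding (sum_metric (submetric Z N) U) (sum_metric Z Y) (\<lambda>(t, x). (t, h t x))"
    using open_lipschitz_embedding_restrict h dom unfolding lipschitz_isotopy_def by metis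
  moreover have "(\<lambda>(t, x). (t, h t x)) ` mspace (sum_metric (submetric Z N) U) \<subseteq> N \<times> mspace Y"
    using h by (auto simp: lipschitz_isotopy_def open_lipschitz_embedding_iff Pi_iff)
  ultimately show ?thesis
    unfolding lipschitz_isotopy_def cod[symmetric] by (rule open_lipschitz_embedding_into_submetric)
qed

lemma lipschitz_isotopy_imp_continuous_map:
  assumes "lipschitz_isotopy Z U Y h"
  shows "continuous_map (prod_topology (mtopology_of Z) (mtopology_of U)) (mtopology_of Y)
           (\<lambda>(t, x). h t x)"
proof -
  have "continuous_map (prod_topology (mtopology_of Z) (mtopology_of U))
          (prod_topology (mtopology_of Z) (mtopology_of Y)) (\<lambda>(t, x). (t, h t x))"
    using open_lipschitz_embedding_imp_continuous_map[OF assms[unfolded lipschitz_isotopy_def]]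
    unfolding mtopology_of_sum_metric .
  from continuous_map_compose[OF this continuous_map_snd] show ?thesis
    by (simp add: comp_def case_prod_unfold)
qed

lemma lipschitz_isotopy_slice:
  assumes h: "lipschitz_isotopy Z U Y h" and t: "t \<in> mspace Z"
  shows "open_lipschitz_embedding U Y (h t)"
  unfolding open_lipschitz_embedding_iff
proof (intro conjI)
  let ?H = "\<lambda>(t, x). (t, h t x)"
  have H: "open_lipschitz_embedding (sum_metric Z U) (sum_metric Z Y) ?H"
    using h by (simp add: lipschitz_isotopy_def)
  show "h t \<in> mspace U \<rightarrow> mspace Y" "inj_on (h t) (mspace U)"
    using H t by (auto simp: open_lipschitz_embedding_iff inj_on_def Pi_iff)
  show "open_map (mtopology_of U) (mtopology_of Y) (h t)"
    unfolding open_map_def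
  proof (intro allI impI)
    fix Q assume Q: "openin (mtopology_of U) Q"
    have "openin (mtopology_of (sum_metric Z U)) (mspace Z \<times> Q)"
      using Q by (intro openin_sum_metric_Times openin_mspace)
    then have "openin (prod_topology (mtopology_of Z) (mtopology_of Y)) (?H ` (mspace Z \<times> Q))"
      using H by (simp add: open_lipschitz_embedding_def open_map_def mtopology_of_sum_metric)
    moreover have "continuous_map (mtopology_of Y) (prod_topology (mtopology_of Z) (mtopology_of Y)) (Pair t)"
      using t by (simp add: continuous_map_pairedI)
    ultimately have "openin (mtopology_of Y) {y \<in> topspace (mtopology_of Y). (t, y) \<in> ?H ` (mspace Z \<times> Q)}"
      by (rule openin_continuous_map_preimage[rotated])
    \<comment> \<open>As the total map preserves the parameter, the slice at \<open>t\<close> of the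
      image of \<open>mspace Z \<times> Q\<close> is exactly the image of \<open>Q\<close> under
      \<open>h t\<close>.\<close>
    moreover have "{y \<in> topspace (mtopology_of Y). (t, y) \<in> ?H ` (mspace Z \<times> Q)} = h t ` Q"
      using t \<open>h t \<in> mspace U \<rightarrow> mspace Y\<close> openin_mtopology_of_subset[OF Q] by auto
    ultimately show "openin (mtopology_of Y) (h t ` Q)"
      by simp
  qed
  show "locally_bilipschitz U Y (h t)"
    unfolding locally_bilipschitz_def
  proof
    fix x assume x: "x \<in> mspace U"
    with t have "(t, x) \<in> mspace (sum_metric Z U)"
      by simp
    from open_lipschitz_embedding_bilipschitzE[OF H this] obtain Q L
      where Q: "openin (mtopology_of (sum_metric Z U)) Q" "(t, x) \<in> Q" "0 \<le> L"
      and L: "\<And>u v. u \<in> Q \<Longrightarrow> v \<in> Q \<Longrightarrow>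
           mdist (sum_metric Z Y) (?H u) (?H v) \<le> L * mdist (sum_metric Z U) u v \<and>
           mdist (sum_metric Z U) u v \<le> L * mdist (sum_metric Z Y) (?H u) (?H v)"
      by blast
    have "continuous_map (mtopology_of U) (mtopology_of (sum_metric Z U)) (Pair t)"
      using t by (simp add: continuous_map_pairedI mtopology_of_sum_metric)
    from openin_continuous_map_preimage[OF this Q(1)]
    have "openin (mtopology_of U) {u \<in> mspace U. (t, u) \<in> Q}"
      by simp
    \<comment> \<open>Between points with the same parameter the sum metric reduces to its second
      summand.\<close>
    moreover have zero: "mdist Z t t = 0"
      using t by simp
    have "\<forall>u\<in>{u \<in> mspace U. (t, u) \<in> Q}. \<forall>v\<in>{u \<in> mspace U. (t, u) \<in> Q}.
            mdist Y (h t u) (h t v) \<le> L * mdist U u v \<and> mdist U u v \<le> L * mdist Y (h t u) (h t v)"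
      using L[of "(t, _)" "(t, _)"] by (auto simp: zero)
    ultimately show "\<exists>Q L. openin (mtopology_of U) Q \<and> x \<in> Q \<and> 0 \<le> L \<and>
        (\<forall>u\<in>Q. \<forall>v\<in>Q. mdist Y (h t u) (h t v) \<le> L * mdist U u v \<and>
                       mdist U u v \<le> L * mdist Y (h t u) (h t v))"
      using x Q by (intro exI[of _ "{u \<in> mspace U. (t, u) \<in> Q}"] exI[of _ L]) auto
  qed
qed

section \<open>Compact slices, the compact-open topology and compact neighbourhoods\<close>

text \<open>The tube lemma: an open set containing \<open>K \<times> {t}\<close> contains
  \<open>K \<times> N\<close> for some neighbourhood \<open>N\<close> of \<open>t\<close>. It
  justifies every passage to parameters close to \<open>b\<close> that rests on compactness.\<close>

lemma compact_slice_nbhd: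
  assumes f: "continuous_map (prod_topology S T) R f" and K: "compactin S K"
    and t: "t \<in> topspace T" and Q: "openin R Q" and sub: "\<And>k. k \<in> K \<Longrightarrow> f (k, t) \<in> Q"
  obtains N where "openin T N" "t \<in> N" "\<And>k s. k \<in> K \<Longrightarrow> s \<in> N \<Longrightarrow> f (k, s) \<in> Q"
proof -
  have "openin (prod_topology S T) {z \<in> topspace (prod_topology S T). f z \<in> Q}"
    using f Q by (rule openin_continuous_map_preimage)
  moreover have "K \<times> {t} \<subseteq> {z \<in> topspace (prod_topology S T). f z \<in> Q}"
    using sub t compactin_subset_topspace[OF K] by auto
  ultimately obtain O' N where "openin T N" "K \<subseteq> O'" "t \<in> N"
    "O' \<times> N \<subseteq> {z \<in> topspace (prod_topology S T). f z \<in> Q}"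
    using tube_lemma_left[OF _ K t] by meson
  then show thesis
    using that[of N] by (auto simp: subset_iff)
qed

text \<open>Preimages of subbasic sets are open by the tube lemma: if \<open>h t\<close> carries the
  compact set \<open>K\<close> into \<open>Q\<close>, so does \<open>h s\<close> for all
  \<open>s\<close> near \<open>t\<close>.\<close>

lemma continuous_map_into_compact_open_topology:
  assumes h: "continuous_map (prod_topology T S) R (\<lambda>(t, x). h t x)"
  shows "continuous_map T (compact_open_topology S R) (\<lambda>t. restrict (h t) (topspace S))"
  unfolding compact_open_topology_def
proof (rule continuous_on_generated_topo)
  have cont: "continuous_map S R (restrict (h t) (topspace S))" if "t \<in> topspace T" for t
  proof -
    have "continuous_map S (prod_topology T S) (Pair t)"
      using that by (simp add: continuous_map_pairedI)
    from continuous_map_compose[OF this h] have "continuous_map S R (h t)"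
      by (simp add: comp_def)
    then show ?thesis
      by (rule continuous_map_eq) simp
  qed
  let ?B = "{{f \<in> extensional (topspace S). continuous_map S R f \<and> f ` K \<subseteq> Q} | K Q.
          compactin S K \<and> openin R Q}"
  show "(\<lambda>t. restrict (h t) (topspace S)) ` topspace T \<subseteq> \<Union>?B"
  proof clarify
    fix t assume "t \<in> topspace T"
    \<comment> \<open>The generator with \<open>K\<close> and \<open>Q\<close> both empty contains
      every continuous extensional map, so the generators cover all values of the family.\<close>
    then have "restrict (h t) (topspace S) \<in>
        {f \<in> extensional (topspace S). continuous_map S R f \<and> f ` {} \<subseteq> {}}"
      using cont by simp
    then show "restrict (h t) (topspace S) \<in> \<Union>?B"
      by (rule UnionI[rotated]) (use compactin_empty openin_empty in blast)
  qed
  fix G assume "G \<in> ?B"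
  then obtain K Q where G: "G = {f \<in> extensional (topspace S). continuous_map S R f \<and> f ` K \<subseteq> Q}"
    and K: "compactin S K" and Q: "openin R Q"
    by blast
  have KS: "K \<subseteq> topspace S"
    using K by (rule compactin_subset_topspace)
  have h': "continuous_map (prod_topology S T) R (\<lambda>(x, t). h t x)"
    using continuous_map_compose[OF homeomorphic_imp_continuous_map[OF homeomorphic_map_swap] h]
    by (simp add: comp_def case_prod_unfold)
  have "openin T {t \<in> topspace T. h t ` K \<subseteq> Q}"
  proof (subst openin_subopen, rule ballI)
    fix t assume "t \<in> {t \<in> topspace T. h t ` K \<subseteq> Q}"
    then obtain N where N: "openin T N" "t \<in> N" "\<And>k s. k \<in> K \<Longrightarrow> s \<in> N \<Longrightarrow> h s k \<in> Q"
      using compact_slice_nbhd[OF h' K _ Q, of t] by (auto simp: image_subset_iff)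
    then show "\<exists>N. openin T N \<and> t \<in> N \<and> N \<subseteq> {t \<in> topspace T. h t ` K \<subseteq> Q}"
      using openin_subset[OF N(1)] by (intro exI[of _ N]) auto
  qed
  moreover have "{t \<in> topspace T. h t ` K \<subseteq> Q} = (\<lambda>t. restrict (h t) (topspace S)) -` G \<inter> topspace T"
    using cont KS by (auto simp: G)
  ultimately show "openin T ((\<lambda>t. restrict (h t) (topspace S)) -` G \<inter> topspace T)"
    by simp
qed

text \<open>Puts the family into the space on which the extension rule of \<open>Lstar\<close>
  lives, so that the parameters whose map falls in a given open set of embeddings form an open set.
  Restriction to \<open>U\<close> makes the values extensional.\<close>

lemma continuous_map_into_open_embedding_space:
  assumes h: "lipschitz_isotopy Z (submetric Y U) Y h" and U: "U \<subseteq> mspace Y"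
  shows "continuous_map (mtopology_of Z) (open_embedding_space Y U) (\<lambda>t. restrict (h t) U)"
proof -
  have "continuous_map (mtopology_of Z)
     (compact_open_topology (mtopology_of (submetric Y U)) (mtopology_of Y)) (\<lambda>t. restrict (h t) U)"
    using continuous_map_into_compact_open_topology[OF lipschitz_isotopy_imp_continuous_map[OF h]]
    unfolding topspace_mtopology_of mspace_submetric_subset[OF U] .
  moreover have "open_lipschitz_embedding (submetric Y U) Y (restrict (h t) U)" if "t \<in> mspace Z" for t
    using lipschitz_isotopy_slice[OF h that] by (rule open_lipschitz_embedding_cong) (use U in auto)
  ultimately show ?thesis
    by (simp add: open_embedding_space_def continuous_map_in_subtopology image_subset_iff)
qed

text \<open>The open subspace \<open>U\<close> is itself locally compact and Hausdorff. Taking the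
  compact neighbourhood of \<open>K\<close> there keeps it inside \<open>U\<close>.\<close>

lemma locally_compact_Hausdorff_compact_nbhd:
  assumes X: "locally_compact_space X" "Hausdorff_space X" and K: "compactin X K"
    and U: "openin X U" "K \<subseteq> U"
  obtains G L where "openin X G" "compactin X L" "K \<subseteq> G" "G \<subseteq> L" "L \<subseteq> U"
proof -
  have "locally_compact_space (subtopology X U)"
    using X U(1) by (intro locally_compact_space_open_subset) auto
  moreover have "Hausdorff_space (subtopology X U)"
    using X(2) by (rule Hausdorff_space_subtopology)
  moreover have "compactin (subtopology X U) K"
    using K U(2) by (simp add: compactin_subtopology)
  ultimately obtain G L where "openin (subtopology X U) G" "compactin (subtopology X U) L" "K \<subseteq> G" "G \<subseteq> L"
    using locally_compact_space_compact_closed_compact by metis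
  then show thesis
    using that[of G L] U(1) by (simp add: compactin_subtopology openin_open_subtopology)
qed

section \<open>From charts to isotopies and back\<close>

text \<open>Compose \<open>f\<close> with the inverse of \<open>g\<close> and conjugate by the swap.
  Since \<open>p\<close> returns the parameter on both charts, the result preserves it and has the
  form \<open>(t, x) \<mapsto> (t, \<phi> t x)\<close>.\<close>

lemma lipschitz_isotopy_transition:
  fixes F E :: "'e metric" and X :: "'x metric"
  assumes N: "openin (mtopology_of X) N" and U: "U \<subseteq> mspace F" and V: "openin (mtopology_of F) V"
    and f: "open_lipschitz_embedding (submetric (sum_metric F X) (U \<times> N)) E f"
    and g: "open_lipschitz_embedding (submetric (sum_metric F X) (V \<times> N)) E g"
    and pf: "\<And>u t. u \<in> U \<Longrightarrow> t \<in> N \<Longrightarrow> p (f (u, t)) = t"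
    and pg: "\<And>v t. v \<in> V \<Longrightarrow> t \<in> N \<Longrightarrow> p (g (v, t)) = t"
    and sub: "f ` (U \<times> N) \<subseteq> g ` (V \<times> N)"
  obtains \<phi> where "lipschitz_isotopy (submetric X N) (submetric F U) F \<phi>"
    and "\<And>t x. t \<in> N \<Longrightarrow> x \<in> U \<Longrightarrow> \<phi> t x \<in> V \<and> g (\<phi> t x, t) = f (x, t)"
proof -
  let ?G = "inv_into (V \<times> N) g"
  define \<phi> where "\<phi> t x = fst (?G (f (x, t)))" for t x
  have NX: "N \<subseteq> mspace X" and VF: "V \<subseteq> mspace F"
    using N V by (simp_all add: openin_mtopology_of_subset)
  then have mspace_V: "mspace (submetric (sum_metric F X) (V \<times> N)) = V \<times> N"
    and mspace_U: "mspace (submetric (sum_metric F X) (U \<times> N)) = U \<times> N"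
    using U by auto
  have Gf: "?G (f (x, t)) = (\<phi> t x, t) \<and> \<phi> t x \<in> V \<and> g (\<phi> t x, t) = f (x, t)"
    if "t \<in> N" "x \<in> U" for t x
  proof -
    have im: "f (x, t) \<in> g ` (V \<times> N)"
      using that sub by blast
    then have "?G (f (x, t)) \<in> V \<times> N" "g (?G (f (x, t))) = f (x, t)"
      by (simp_all add: inv_into_into f_inv_into_f del: mem_Times_iff)
    moreover obtain v s where vs: "?G (f (x, t)) = (v, s)"
      by fastforce
    ultimately have "v \<in> V" "s \<in> N" "g (v, s) = f (x, t)"
      by simp_all
    \<comment> \<open>Applying \<open>p\<close> to \<open>g (v, s) = f (x, t)\<close> identifies the
      parameters.\<close>
    moreover from this have "s = t"
      using pf[of x t] pg[of v s] that by simp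
    ultimately show ?thesis
      using vs by (simp add: \<phi>_def)
  qed
  have f': "open_lipschitz_embedding (sum_metric (submetric F U) (submetric X N))
      (submetric E (g ` (V \<times> N))) f"
    unfolding submetric_sum_metric[symmetric]
    using f sub mspace_U by (intro open_lipschitz_embedding_into_submetric) auto
  have G: "open_lipschitz_embedding (submetric E (g ` (V \<times> N)))
      (sum_metric (submetric F V) (submetric X N)) ?G"
    using open_lipschitz_embedding_inv_into[OF g] unfolding mspace_V unfolding submetric_sum_metric .
  have "open_lipschitz_embedding (sum_metric (submetric X N) (submetric F U))
      (sum_metric (submetric X N) (submetric F V)) (prod.swap \<circ> (?G \<circ> (f \<circ> prod.swap)))"
    by (rule open_lipschitz_embedding_compose open_lipschitz_embedding_swap f' G)+
  then have "open_lipschitz_embedding (sum_metric (submetric X N) (submetric F U))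
      (sum_metric (submetric X N) (submetric F V)) (\<lambda>(t, x). (t, \<phi> t x))"
    by (rule open_lipschitz_embedding_cong) (use Gf in auto)
  \<comment> \<open>The target \<open>N \<times> V\<close> is open in the product of
    \<open>N\<close> with all of \<open>F\<close>, so enlarging the target keeps the embedding
    open.\<close>
  moreover have "sum_metric (submetric X N) (submetric F V) =
      submetric (sum_metric (submetric X N) F) (N \<times> V)"
    by (simp add: submetric_sum_metric)
  moreover have "openin (mtopology_of (sum_metric (submetric X N) F)) (N \<times> V)"
    using V NX by (intro openin_sum_metric_Times openin_submetric_whole)
  ultimately have "lipschitz_isotopy (submetric X N) (submetric F U) F \<phi>"
    unfolding lipschitz_isotopy_def using open_lipschitz_embedding_from_submetric by metis
  with Gf show thesis
    using that by blast
qed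

text \<open>The new map is \<open>g\<close> precomposed with
  \<open>(x, t) \<mapsto> (\<psi> t x, t)\<close>. The isotopy acts on all of \<open>F\<close>, and
  \<open>maps\<close> keeps it inside the domain of \<open>g\<close>.\<close>

lemma open_lipschitz_embedding_twist:
  fixes F E :: "'e metric" and X :: "'x metric"
  assumes N: "openin (mtopology_of X) N" and V: "openin (mtopology_of F) V"
    and g: "open_lipschitz_embedding (submetric (sum_metric F X) (V \<times> N)) E g"
    and \<psi>: "lipschitz_isotopy (submetric X N) F F \<psi>"
    and maps: "\<And>t x. t \<in> N \<Longrightarrow> x \<in> V \<Longrightarrow> \<psi> t x \<in> V"
  shows "open_lipschitz_embedding (submetric (sum_metric F X) (V \<times> N)) E (\<lambda>(x, t). g (\<psi> t x, t))"
proof -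
  let ?H = "\<lambda>(t, x). (t, \<psi> t x)"
  have NX: "N \<subseteq> mspace X" and VF: "V \<subseteq> mspace F"
    using N V by (simp_all add: openin_mtopology_of_subset)
  have eq: "sum_metric (submetric X N) (submetric F V) =
      submetric (sum_metric (submetric X N) F) (N \<times> V)"
    by (simp add: submetric_sum_metric)
  have "openin (mtopology_of (sum_metric (submetric X N) F)) (N \<times> V)"
    using V NX by (intro openin_sum_metric_Times openin_submetric_whole)
  then have "open_lipschitz_embedding (submetric (sum_metric (submetric X N) F) (N \<times> V))
      (sum_metric (submetric X N) F) ?H"
    using \<psi> unfolding lipschitz_isotopy_def by (intro open_lipschitz_embedding_restrict)
  then have H: "open_lipschitz_embedding (sum_metric (submetric X N) (submetric F V))
      (sum_metric (submetric X N) (submetric F V)) ?H"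
    unfolding eq by (rule open_lipschitz_embedding_into_submetric) (use maps in auto)
  have g': "open_lipschitz_embedding (sum_metric (submetric F V) (submetric X N)) E g"
    using g by (simp add: submetric_sum_metric)
  have "open_lipschitz_embedding (sum_metric (submetric F V) (submetric X N)) E
      (g \<circ> (prod.swap \<circ> (?H \<circ> prod.swap)))"
    by (rule open_lipschitz_embedding_compose open_lipschitz_embedding_swap g' H)+
  then show ?thesis
    unfolding submetric_sum_metric by (rule open_lipschitz_embedding_cong) auto
qed

subsection \<open>Product charts\<close>

text \<open>This is where \<open>Lstar\<close> enters; the isotopies are parametrized by points of
  \<open>X\<close>, hence \<open>TYPE('x)\<close>. The compact set \<open>K\<close> contains the
  region in which points may be moved. Being closed and inside \<open>U\<close>, it leaves an open
  set around \<open>B - U\<close> on which \<open>g\<close> is unchanged.\<close>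

lemma product_chart_deformation:
  fixes F E :: "'e metric" and X :: "'x metric"
  assumes Lstar: "Lstar TYPE('x) F"
    and lc: "locally_compact_space (mtopology_of F)"
    and U: "openin (mtopology_of F) U" and V: "openin (mtopology_of F) V"
    and N0: "openin (mtopology_of X) N0" and b: "b \<in> N0"
    and f: "open_lipschitz_embedding (submetric (sum_metric F X) (U \<times> N0)) E f"
    and g: "open_lipschitz_embedding (submetric (sum_metric F X) (V \<times> N0)) E g"
    and pf: "\<And>u t. u \<in> U \<Longrightarrow> t \<in> N0 \<Longrightarrow> p (f (u, t)) = t"
    and pg: "\<And>v t. v \<in> V \<Longrightarrow> t \<in> N0 \<Longrightarrow> p (g (v, t)) = t"
    and fb: "\<And>u. u \<in> U \<Longrightarrow> f (u, b) = u" and gb: "\<And>v. v \<in> V \<Longrightarrow> g (v, b) = v"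
    and D: "compactin (mtopology_of F) D" "D \<subseteq> U \<inter> V"
  obtains N g' K where "openin (mtopology_of X) N" "b \<in> N" "N \<subseteq> N0"
    and "compactin (mtopology_of F) K" "K \<subseteq> U"
    and "open_lipschitz_embedding (submetric (sum_metric F X) (V \<times> N)) E g'"
    and "\<And>v t. v \<in> V \<Longrightarrow> t \<in> N \<Longrightarrow> p (g' (v, t)) = t"
    and "\<And>v. v \<in> V \<Longrightarrow> g' (v, b) = v"
    and "\<And>v t. v \<in> D \<Longrightarrow> t \<in> N \<Longrightarrow> g' (v, t) = f (v, t)"
    and "\<And>v t. v \<in> V - K \<Longrightarrow> t \<in> N \<Longrightarrow> g' (v, t) = g (v, t)"
proof -
  have N0X: "N0 \<subseteq> mspace X" and UF: "U \<subseteq> mspace F" and VF: "V \<subseteq> mspace F"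
    using N0 U V by (simp_all add: openin_mtopology_of_subset)
  obtain G K where G: "openin (mtopology_of F) G" and K: "compactin (mtopology_of F) K"
    and GK: "D \<subseteq> G" "G \<subseteq> K" "K \<subseteq> U \<inter> V"
    using locally_compact_Hausdorff_compact_nbhd[OF lc Hausdorff_space_mtopology_of D(1) openin_Int[OF U V] D(2)]
    by blast
  have GF: "G \<subseteq> mspace F"
    using G by (rule openin_mtopology_of_subset)

  have "mspace (submetric (sum_metric F X) (V \<times> N0)) = V \<times> N0"
    using VF N0X by auto
  then have open_g: "openin (mtopology_of E) (g ` (V \<times> N0))"
    using open_lipschitz_embedding_openin_image[OF g] by simp
  have "continuous_map (prod_topology (subtopology (mtopology_of F) U) (subtopology (mtopology_of X) N0))
      (mtopology_of E) f"
    using open_lipschitz_embedding_imp_continuous_map[OF f]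
    by (simp add: submetric_sum_metric mtopology_of_sum_metric mtopology_of_submetric)
  moreover have "compactin (subtopology (mtopology_of F) U) K"
    using K GK by (simp add: compactin_subtopology)
  moreover have "b \<in> topspace (subtopology (mtopology_of X) N0)"
    using b N0X by auto
  \<comment> \<open>Over \<open>b\<close> both charts are the inclusion, so
    \<open>f (k, b) = k = g (k, b)\<close>. This is the starting point for the tube lemma.\<close>
  moreover have "f (k, b) \<in> g ` (V \<times> N0)" if "k \<in> K" for k
    using that GK fb gb[of k] b by (metis IntD1 IntD2 SigmaI imageI subsetD)
  ultimately obtain N1 where N1: "openin (subtopology (mtopology_of X) N0) N1" "b \<in> N1"
    and fN1: "\<And>k t. k \<in> K \<Longrightarrow> t \<in> N1 \<Longrightarrow> f (k, t) \<in> g ` (V \<times> N0)"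
    using compact_slice_nbhd[of _ _ _ f K b "g ` (V \<times> N0)"] open_g by metis
  have N1X: "openin (mtopology_of X) N1" and N1N0: "N1 \<subseteq> N0"
    using N1(1) N0 by (auto simp: openin_open_subtopology)
  \<comment> \<open>Comparing values of \<open>p\<close> shows that the matching point of
    \<open>V \<times> N0\<close> lies over the same \<open>t\<close>, hence in
    \<open>V \<times> N1\<close>.\<close>
  have fN1': "f ` (G \<times> N1) \<subseteq> g ` (V \<times> N1)"
  proof clarify
    fix x t assume "x \<in> G" "t \<in> N1"
    then obtain v s where "v \<in> V" "s \<in> N0" "f (x, t) = g (v, s)"
      using fN1[of x t] GK by blast
    moreover from this have "s = t"
      using pf[of x t] pg[of v s] \<open>x \<in> G\<close> \<open>t \<in> N1\<close> GK N1N0 by auto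
    ultimately show "f (x, t) \<in> g ` (V \<times> N1)"
      using \<open>t \<in> N1\<close> by auto
  qed
  obtain \<phi> where \<phi>: "lipschitz_isotopy (submetric X N1) (submetric F G) F \<phi>"
    and g\<phi>: "\<And>t x. t \<in> N1 \<Longrightarrow> x \<in> G \<Longrightarrow> \<phi> t x \<in> V \<and> g (\<phi> t x, t) = f (x, t)"
  proof (rule lipschitz_isotopy_transition[OF N1X GF V _ _ _ _ fN1'])
    show "open_lipschitz_embedding (submetric (sum_metric F X) (G \<times> N1)) E f"
      using f by (rule open_lipschitz_embedding_submetric_mono)
        (use G N1X N1N0 GK in \<open>auto intro: openin_sum_metric_Times\<close>)
    show "open_lipschitz_embedding (submetric (sum_metric F X) (V \<times> N1)) E g"
      using g by (rule open_lipschitz_embedding_submetric_mono)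
        (use V N1X N1N0 in \<open>auto intro: openin_sum_metric_Times\<close>)
    show "p (f (u, t)) = t" if "u \<in> G" "t \<in> N1" for u t
      using that pf GK N1N0 by blast
    show "p (g (v, t)) = t" if "v \<in> V" "t \<in> N1" for v t
      using that pg N1N0 by blast
  qed blast
  \<comment> \<open>Because \<open>g\<close> and \<open>f\<close> are the identity over
    \<open>b\<close>, \<open>\<phi> b x = g (\<phi> b x, b) = f (x, b) = x\<close>.\<close>
  have \<phi>b: "\<phi> b x = x" if "x \<in> G" for x
    using g\<phi>[of b x] gb[of "\<phi> b x"] fb[of x] that N1(2) GK by auto

  \<comment> \<open>\<open>Lstar\<close> is applied to the open set \<open>G\<close> and the compact
    set \<open>D\<close>, so the extended maps will be the identity off \<open>G\<close>.\<close>
  obtain \<N> \<Phi> where \<N>: "openin (open_embedding_space F G) \<N>" "restrict id G \<in> \<N>"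
    and \<Phi>id: "\<Phi> (restrict id G) = restrict id (mspace F)"
    and \<Phi>D: "\<And>h x. h \<in> \<N> \<Longrightarrow> x \<in> D \<Longrightarrow> \<Phi> h x = h x"
    and \<Phi>F: "\<And>h x. h \<in> \<N> \<Longrightarrow> x \<in> mspace F - G \<Longrightarrow> \<Phi> h x = x"
    and \<Phi>P: "\<And>(Z :: 'x metric) h. (\<And>t. t \<in> mspace Z \<Longrightarrow> h t \<in> \<N>) \<Longrightarrow>
               lipschitz_isotopy Z (submetric F G) F h \<Longrightarrow> lipschitz_isotopy Z F F (\<lambda>t. \<Phi> (h t))"
  proof -
    have "openin (mtopology_of F) G \<and> compactin (mtopology_of F) D \<and> D \<subseteq> G"
      using G D GK by blast
    with Lstar show thesis
      unfolding Lstar_def using that by (smt (verit, ccfv_threshold))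
  qed

  define \<phi>' where "\<phi>' t = restrict (\<phi> t) G" for t
  have cont: "continuous_map (mtopology_of (submetric X N1)) (open_embedding_space F G) \<phi>'"
    unfolding \<phi>'_def using continuous_map_into_open_embedding_space[OF \<phi> GF] .
  \<comment> \<open>These are the parameters for which the extension is controlled. They form an
    open set by \<open>cont\<close>, and \<open>b\<close> is among them because
    \<open>\<phi>' b\<close> is the inclusion of \<open>G\<close>.\<close>
  define N where "N = {t \<in> N1. \<phi>' t \<in> \<N>}"
  have mspace_N1: "mspace (submetric X N1) = N1"
    using openin_mtopology_of_subset[OF N1X] by (rule mspace_submetric_subset)
  have "openin (mtopology_of (submetric X N1)) N"
    using openin_continuous_map_preimage[OF cont \<N>(1)]
    unfolding topspace_mtopology_of mspace_N1 N_def .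
  then have N: "openin (mtopology_of X) N" and NN1: "N \<subseteq> N1"
    using N1X by (simp_all add: mtopology_of_submetric openin_open_subtopology)
  have bN: "b \<in> N"
  proof -
    have "\<phi>' b = restrict id G"
      using \<phi>b by (auto simp: \<phi>'_def)
    then show ?thesis
      using N1(2) \<N>(2) by (simp add: N_def)
  qed
  define \<psi> where "\<psi> t = \<Phi> (\<phi>' t)" for t
  have "lipschitz_isotopy (submetric X N1) (submetric F G) F \<phi>'"
    using \<phi> by (rule lipschitz_isotopy_cong) (use GF in \<open>auto simp: \<phi>'_def\<close>)
  moreover have "openin (mtopology_of (submetric X N1)) N"
    by fact
  ultimately have "lipschitz_isotopy (submetric X N) (submetric F G) F \<phi>'"
    using lipschitz_isotopy_restrict NN1 by (metis inf.absorb_iff2 submetric_submetric)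
  \<comment> \<open>Property (P), with the subspace \<open>N\<close> of \<open>X\<close> as
    parameter space.\<close>
  then have \<psi>: "lipschitz_isotopy (submetric X N) F F \<psi>"
    unfolding \<psi>_def by (rule \<Phi>P[rotated]) (auto simp: N_def)
  have \<psi>_out: "\<psi> t x = x" if "t \<in> N" "x \<in> mspace F - G" for t x
    using that \<Phi>F by (simp add: \<psi>_def N_def)
  \<comment> \<open>An injective map that fixes every point off \<open>G\<close> sends
    \<open>G\<close> into itself: a value off \<open>G\<close> would be a fixed point, so by
    injectivity it would equal the point of \<open>G\<close> it came from.\<close>
  have \<psi>_V: "\<psi> t x \<in> V" if "t \<in> N" "x \<in> V" for t x
  proof (cases "x \<in> G")
    case True
    have "t \<in> mspace (submetric X N)"
      using that(1) N openin_mtopology_of_subset by auto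
    then have "open_lipschitz_embedding F F (\<psi> t)"
      using lipschitz_isotopy_slice[OF \<psi>] by blast
    then have inj: "inj_on (\<psi> t) (mspace F)" and maps: "\<psi> t x \<in> mspace F"
      using that(2) VF by (auto simp: open_lipschitz_embedding_iff)
    have "\<psi> t x \<in> G"
    proof (rule ccontr)
      assume "\<psi> t x \<notin> G"
      then have "\<psi> t (\<psi> t x) = \<psi> t x"
        using \<psi>_out maps that(1) by blast
      then have "\<psi> t x = x"
        using inj maps that(2) VF by (metis inj_onD subsetD)
      with True \<open>\<psi> t x \<notin> G\<close> show False
        by simp
    qed
    then show ?thesis
      using GK by blast
  next
    case False
    then show ?thesis
      using that \<psi>_out[of t x] VF by auto
  qed
  show thesis
  proof
    show "openin (mtopology_of X) N" "b \<in> N" "N \<subseteq> N0" "compactin (mtopology_of F) K" "K \<subseteq> U"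
      using N bN NN1 N1N0 K GK by auto
    show "open_lipschitz_embedding (submetric (sum_metric F X) (V \<times> N)) E (\<lambda>(x, t). g (\<psi> t x, t))"
    proof (rule open_lipschitz_embedding_twist[OF N V _ \<psi> \<psi>_V])
      show "open_lipschitz_embedding (submetric (sum_metric F X) (V \<times> N)) E g"
        using g by (rule open_lipschitz_embedding_submetric_mono)
          (use V N NN1 N1N0 in \<open>auto intro: openin_sum_metric_Times\<close>)
    qed
    show "p ((\<lambda>(x, t). g (\<psi> t x, t)) (v, t)) = t" if "v \<in> V" "t \<in> N" for v t
      using that pg \<psi>_V NN1 N1N0 by auto
    show "(\<lambda>(x, t). g (\<psi> t x, t)) (v, b) = v" if "v \<in> V" for v
    proof -
      have "\<phi>' b = restrict id G"
        using \<phi>b by (auto simp: \<phi>'_def)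
      then have "\<psi> b v = v"
        using that VF \<Phi>id by (auto simp: \<psi>_def)
      then show ?thesis
        using gb that by simp
    qed
    show "(\<lambda>(x, t). g (\<psi> t x, t)) (v, t) = f (v, t)" if "v \<in> D" "t \<in> N" for v t
    proof -
      have "\<psi> t v = \<phi> t v"
        using that \<Phi>D[of "\<phi>' t" v] GK by (auto simp: \<psi>_def N_def \<phi>'_def)
      then show ?thesis
        using g\<phi>[of t v] that GK NN1 by auto
    qed
    show "(\<lambda>(x, t). g (\<psi> t x, t)) (v, t) = g (v, t)" if "v \<in> V - K" "t \<in> N" for v t
    proof -
      have "v \<in> mspace F - G"
        using that(1) GK VF by blast
      then show ?thesis
        using \<psi>_out[OF that(2)] by simp
    qed
  qed
qed

text \<open>Over \<open>b\<close> the two images are the disjoint compact sets \<open>K\<close> and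
  \<open>L\<close>, which are also compact in \<open>E\<close> because \<open>F\<close> carries the
  restricted metric. Disjoint open neighbourhoods in \<open>E\<close> keep the images apart for all
  parameters near \<open>b\<close>, by the tube lemma.\<close>

lemma product_chart_separation:
  fixes F E :: "'e metric" and X :: "'x metric"
  assumes F: "F = submetric E S" and N: "openin (mtopology_of X) N" "b \<in> N"
    and f: "open_lipschitz_embedding (submetric (sum_metric F X) (U \<times> N)) E f"
    and g: "open_lipschitz_embedding (submetric (sum_metric F X) (V \<times> N)) E g"
    and fb: "\<And>u. u \<in> U \<Longrightarrow> f (u, b) = u" and gb: "\<And>v. v \<in> V \<Longrightarrow> g (v, b) = v"
    and K: "compactin (mtopology_of F) K" "K \<subseteq> U"
    and L: "compactin (mtopology_of F) L" "L \<subseteq> V"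
    and disj: "disjnt K L"
  obtains N' where "openin (mtopology_of X) N'" "b \<in> N'" "N' \<subseteq> N"
    and "\<And>u v t. u \<in> K \<Longrightarrow> v \<in> L \<Longrightarrow> t \<in> N' \<Longrightarrow> f (u, t) \<noteq> g (v, t)"
proof -
  have "compactin (mtopology_of E) K" "compactin (mtopology_of E) L"
    using K L by (simp_all add: F mtopology_of_submetric compactin_subtopology)
  then obtain P Q where PQ: "openin (mtopology_of E) P" "openin (mtopology_of E) Q"
    "K \<subseteq> P" "L \<subseteq> Q" "disjnt P Q"
    using Hausdorff_space_compact_sets[of "mtopology_of E"] disj by (metis Hausdorff_space_mtopology_of)
  have bN: "b \<in> topspace (subtopology (mtopology_of X) N)"
    using N openin_mtopology_of_subset[OF N(1)] by auto
  have cont: "continuous_map (prod_topology (subtopology (mtopology_of F) W) (subtopology (mtopology_of X) N))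
      (mtopology_of E) k"
    if "open_lipschitz_embedding (submetric (sum_metric F X) (W \<times> N)) E k" for W k
    using open_lipschitz_embedding_imp_continuous_map[OF that]
    by (simp add: submetric_sum_metric mtopology_of_sum_metric mtopology_of_submetric)
  have KU: "compactin (subtopology (mtopology_of F) U) K"
    and LV: "compactin (subtopology (mtopology_of F) V) L"
    using K L by (simp_all add: compactin_subtopology)
  have fP: "f (k, b) \<in> P" if "k \<in> K" for k
    using that K(2) PQ(3) fb by (metis subsetD)
  have gQ: "g (k, b) \<in> Q" if "k \<in> L" for k
    using that L(2) PQ(4) gb by (metis subsetD)
  obtain N1 where N1: "openin (subtopology (mtopology_of X) N) N1" "b \<in> N1"
      "\<And>k t. k \<in> K \<Longrightarrow> t \<in> N1 \<Longrightarrow> f (k, t) \<in> P"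
    using compact_slice_nbhd[OF cont[OF f] KU bN PQ(1) fP] by blast
  obtain N2 where N2: "openin (subtopology (mtopology_of X) N) N2" "b \<in> N2"
      "\<And>k t. k \<in> L \<Longrightarrow> t \<in> N2 \<Longrightarrow> g (k, t) \<in> Q"
    using compact_slice_nbhd[OF cont[OF g] LV bN PQ(2) gQ] by blast
  show thesis
  proof
    show "openin (mtopology_of X) (N1 \<inter> N2)" "b \<in> N1 \<inter> N2" "N1 \<inter> N2 \<subseteq> N"
      using N1(1,2) N2(1,2) N(1) by (auto simp: openin_open_subtopology)
    show "f (u, t) \<noteq> g (v, t)" if "u \<in> K" "v \<in> L" "t \<in> N1 \<inter> N2" for u v t
      using N1(3)[of u t] N2(3)[of v t] that PQ(5) by (auto simp: disjnt_iff)
  qed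
qed

lemma lipschitz_product_chart_restrict:
  assumes f: "lipschitz_product_chart E X p b U N f" and F: "F = fiber E p b"
    and T: "openin (mtopology_of X) T" "T \<subseteq> N"
  shows "open_lipschitz_embedding (submetric (sum_metric F X) (U \<times> T)) E f"
proof (rule open_lipschitz_embedding_submetric_mono)
  show "open_lipschitz_embedding (submetric (sum_metric F X) (U \<times> N)) E f"
    using f by (simp add: F submetric_sum_metric lipschitz_product_chart_def)
  show "openin (mtopology_of (sum_metric F X)) (U \<times> T)" "U \<times> T \<subseteq> U \<times> N"
    using f T by (auto simp: F lipschitz_product_chart_def intro: openin_sum_metric_Times)
qed

section \<open>Gluing the first chart to the deformed second chart\<close>

theorem lemma4p13:
  fixes E :: "'e metric" and X :: "'x metric" and p :: "'e \<Rightarrow> 'x"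
    and y :: 'e and b :: 'x and F :: "'e metric"
    and U V A B :: "'e set" and N1 N2 :: "'x set"
    and f g :: "'e \<times> 'x \<Rightarrow> 'e"
  assumes "lipschitz_submersion E X p"
    and "locally_compact_space (mtopology_of X)"
    and "locally_connected_space (mtopology_of X)"
    and "y \<in> mspace E" and "b = p y" and "F = fiber E p b"
    and "locally_compact_space (mtopology_of F)"
    and "locally_connected_space (mtopology_of F)"
    and "Lstar TYPE('x) F"
    and "lipschitz_product_chart E X p b U N1 f"
    and "lipschitz_product_chart E X p b V N2 g"
    and "compactin (mtopology_of F) A" and "A \<subseteq> U"
    and "compactin (mtopology_of F) B" and "B \<subseteq> V"
  shows "\<exists>W N h.
    openin (mtopology_of F) W \<and> A \<union> B \<subseteq> W \<and>
    nbhd_of (mtopology_of X) {b} N \<and>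
    lipschitz_product_chart E X p b W N h \<and>
    agree_near (mtopology_of (sum_metric F X)) (A \<times> {b}) (W \<times> N) h (U \<times> N1) f \<and>
    agree_near (mtopology_of (sum_metric F X)) ((B - U) \<times> {b}) (W \<times> N) h (V \<times> N2) g"
proof -
  note F = \<open>F = fiber E p b\<close> and lc = \<open>locally_compact_space (mtopology_of F)\<close>
  note f = \<open>lipschitz_product_chart E X p b U N1 f\<close> and g = \<open>lipschitz_product_chart E X p b V N2 g\<close>
  have U: "openin (mtopology_of F) U" and V: "openin (mtopology_of F) V"
    and pf: "\<And>u t. u \<in> U \<Longrightarrow> t \<in> N1 \<Longrightarrow> p (f (u, t)) = t" and fb: "\<And>u. u \<in> U \<Longrightarrow> f (u, b) = u"
    and pg: "\<And>v t. v \<in> V \<Longrightarrow> t \<in> N2 \<Longrightarrow> p (g (v, t)) = t" and gb: "\<And>v. v \<in> V \<Longrightarrow> g (v, b) = v"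
    using f g by (auto simp: lipschitz_product_chart_def F)
  obtain M1 M2 where M: "openin (mtopology_of X) M1" "b \<in> M1" "M1 \<subseteq> N1"
      "openin (mtopology_of X) M2" "b \<in> M2" "M2 \<subseteq> N2"
    using f g by (auto simp: lipschitz_product_chart_def nbhd_of_def)
  define N0 where "N0 = M1 \<inter> M2"
  have N0: "openin (mtopology_of X) N0" "b \<in> N0" "N0 \<subseteq> N1" "N0 \<subseteq> N2"
    using M by (auto simp: N0_def)
  have f0: "open_lipschitz_embedding (submetric (sum_metric F X) (U \<times> T)) E f"
    and g0: "open_lipschitz_embedding (submetric (sum_metric F X) (V \<times> T)) E g"
    if "openin (mtopology_of X) T" "T \<subseteq> N0" for T
    using that N0 lipschitz_product_chart_restrict[OF f F, of T] lipschitz_product_chart_restrict[OF g F, of T]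
    by auto

  obtain G1 A1 where A1: "openin (mtopology_of F) G1" "compactin (mtopology_of F) A1"
      "A \<subseteq> G1" "G1 \<subseteq> A1" "A1 \<subseteq> U"
    using locally_compact_Hausdorff_compact_nbhd[OF lc] U assms(12,13)
    by (metis Hausdorff_space_mtopology_of)
  obtain G2 B1 where B1: "openin (mtopology_of F) G2" "compactin (mtopology_of F) B1"
      "B \<subseteq> G2" "G2 \<subseteq> B1" "B1 \<subseteq> V"
    using locally_compact_Hausdorff_compact_nbhd[OF lc] V assms(14,15)
    by (metis Hausdorff_space_mtopology_of)
  \<comment> \<open>A second, smaller neighbourhood of \<open>B\<close> is taken inside
    \<open>G2\<close>. Points of \<open>A1\<close> in \<open>G2\<close> then lie in
    \<open>A1 \<inter> B1\<close>, while points of \<open>A1\<close> outside \<open>G2\<close> keep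
    away from \<open>B0\<close>; injectivity is proved by this alternative.\<close>
  obtain G3 B0 where B0: "openin (mtopology_of F) G3" "compactin (mtopology_of F) B0"
      "B \<subseteq> G3" "G3 \<subseteq> B0" "B0 \<subseteq> G2"
    using locally_compact_Hausdorff_compact_nbhd[OF lc] B1(1,3) assms(14)
    by (metis Hausdorff_space_mtopology_of)
  have closed: "closedin (mtopology_of F) C" if "compactin (mtopology_of F) C" for C
    using compactin_imp_closedin[OF _ that] by simp
  define D where "D = A1 \<inter> B1"
  have D: "compactin (mtopology_of F) D" "D \<subseteq> U \<inter> V"
    using A1 B1 closed by (auto simp: D_def intro: closed_Int_compactin)
  obtain N' g' K where N': "openin (mtopology_of X) N'" "b \<in> N'" "N' \<subseteq> N0"
    and K: "compactin (mtopology_of F) K" "K \<subseteq> U"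
    and g': "open_lipschitz_embedding (submetric (sum_metric F X) (V \<times> N')) E g'"
    and pg': "\<And>v t. v \<in> V \<Longrightarrow> t \<in> N' \<Longrightarrow> p (g' (v, t)) = t"
    and g'b: "\<And>v. v \<in> V \<Longrightarrow> g' (v, b) = v"
    and g'D: "\<And>v t. v \<in> D \<Longrightarrow> t \<in> N' \<Longrightarrow> g' (v, t) = f (v, t)"
    and g'K: "\<And>v t. v \<in> V - K \<Longrightarrow> t \<in> N' \<Longrightarrow> g' (v, t) = g (v, t)"
  proof (rule product_chart_deformation[OF \<open>Lstar TYPE('x) F\<close> lc U V N0(1,2) f0 g0 _ _ fb gb D])
    show "p (f (u, t)) = t" if "u \<in> U" "t \<in> N0" for u t
      using that pf N0 by blast
    show "p (g (v, t)) = t" if "v \<in> V" "t \<in> N0" for v t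
      using that pg N0 by blast
  qed (use N0 in auto)
  \<comment> \<open>On \<open>A1 \<inter> G2\<close> the maps \<open>f\<close> and \<open>g'\<close>
    agree over \<open>N'\<close>. The remainder \<open>A1 - G2\<close> is compact and disjoint from
    \<open>B0\<close>, so the separation lemma applies to it.\<close>
  have "compactin (mtopology_of F) ((topspace (mtopology_of F) - G2) \<inter> A1)"
    using A1(2) B1(1) by (intro closed_Int_compactin closedin_diff closedin_topspace)
  moreover have "(topspace (mtopology_of F) - G2) \<inter> A1 = A1 - G2"
    using compactin_subset_topspace[OF A1(2)] by auto
  ultimately have A1G2: "compactin (mtopology_of F) (A1 - G2)" "A1 - G2 \<subseteq> U"
    using A1(5) by auto
  have disj: "disjnt (A1 - G2) B0"
    using B0 by (auto simp: disjnt_iff)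
  have "B0 \<subseteq> V"
    using B0 B1 by auto
  obtain N where N: "openin (mtopology_of X) N" "b \<in> N" "N \<subseteq> N'"
    and sep: "\<And>u v t. u \<in> A1 - G2 \<Longrightarrow> v \<in> B0 \<Longrightarrow> t \<in> N \<Longrightarrow> f (u, t) \<noteq> g' (v, t)"
    using product_chart_separation[OF F[unfolded fiber_def] N'(1,2) f0[OF N'(1,3)] g' fb g'b
        A1G2 B0(2) \<open>B0 \<subseteq> V\<close> disj] by blast
  have N0': "N \<subseteq> N0" "N \<subseteq> N1" "N \<subseteq> N2"
    using N N' N0 by auto

  define W where "W = G1 \<union> G3"
  \<comment> \<open>The split is along the compact set \<open>A1\<close>, but as \<open>f\<close>
    and \<open>g'\<close> agree over \<open>D\<close>, \<open>h\<close> equals \<open>g'\<close> on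
    all of \<open>B1\<close> for parameters in \<open>N\<close>. Hence \<open>h\<close> is a single
    embedding over each of the open sets \<open>G1\<close> and \<open>G3\<close>.\<close>
  define h where "h z = (if fst z \<in> A1 then f z else g' z)" for z
  have W: "openin (mtopology_of F) W"
    using A1 B0 by (simp add: W_def openin_Un)
  have h_f: "h (x, t) = f (x, t)" if "x \<in> A1" for x t
    using that by (simp add: h_def)
  have h_g': "h (x, t) = g' (x, t)" if "x \<in> B1" "t \<in> N" for x t
    using that g'D[of x t] N by (auto simp: h_def D_def)
  have B0V: "B0 \<subseteq> B1" "B0 \<subseteq> V" "G3 \<subseteq> V"
    using B0 B1 by auto

  have W_cases: "x \<in> A1 \<and> x \<in> U \<or> x \<notin> A1 \<and> x \<in> V" if "x \<in> W" for x
    using that A1(4,5) B0V(3) unfolding W_def by blast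
  have ph: "p (h (x, t)) = t" if "x \<in> W" "t \<in> N" for x t
  proof -
    have "t \<in> N1" "t \<in> N'"
      using that(2) N(3) N0'(2) by auto
    then show ?thesis
      using W_cases[OF that(1)] pf[of x t] pg'[of x t] by (auto simp: h_def)
  qed
  have hb: "h (x, b) = x" if "x \<in> W" for x
    using W_cases[OF that] fb[of x] g'b[of x] by (auto simp: h_def)
  have NX: "N \<subseteq> mspace X" and WF: "W \<subseteq> mspace F"
    using N(1) W by (simp_all add: openin_mtopology_of_subset)
  have inj_f: "inj_on f (U \<times> N)" and inj_g': "inj_on g' (V \<times> N')"
  proof -
    have "U \<times> N \<subseteq> mspace (sum_metric F X)" "V \<times> N' \<subseteq> mspace (sum_metric F X)"
      using U V N(1) N'(1) by (simp_all add: openin_mtopology_of_subset Sigma_mono)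
    then show "inj_on f (U \<times> N)" "inj_on g' (V \<times> N')"
      using f0[OF N(1) N0'(1)] g' by (simp_all add: open_lipschitz_embedding_iff Int_absorb2)
  qed
  \<comment> \<open>If \<open>u\<close> is outside \<open>G2\<close>, the equation contradicts
    \<open>sep\<close>. Otherwise \<open>u\<close> lies in \<open>D\<close>, where \<open>f\<close>
    equals \<open>g'\<close>, and injectivity of \<open>g'\<close> gives
    \<open>u = v\<close>.\<close>
  have cross: "u = v" if "u \<in> A1" "v \<in> B0" "t \<in> N" "f (u, t) = g' (v, t)" for u v t
  proof -
    have "u \<in> G2"
      using sep[of u v t] that by blast
    then have "u \<in> B1" "t \<in> N'"
      using that(3) B1(4) N(3) by blast+
    then have "u \<in> V" "g' (u, t) = g' (v, t)" "v \<in> V" "t \<in> N'"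
      using that g'D[of u t] B1(5) B0V(2) by (auto simp: D_def)
    then show "u = v"
      using inj_onD[OF inj_g', of "(u, t)" "(v, t)"] by simp
  qed
  have inj: "inj_on h (W \<times> N)"
  proof (rule inj_onI, clarify)
    fix u s v t assume uv: "u \<in> W" "s \<in> N" "v \<in> W" "t \<in> N" "h (u, s) = h (v, t)"
    \<comment> \<open>Applying \<open>p\<close> to the equation recovers the parameter, so only
      points over the same \<open>t\<close> have to be compared.\<close>
    then have st: "s = t"
      using ph by metis
    have cases: "w \<in> A1 \<or> w \<in> B0 \<and> h (w, t) = g' (w, t)" if "w \<in> W" for w
      using that A1(4) B0(4) B0V(1) h_g'[of w t] uv(4) unfolding W_def by blast
    consider "u \<in> A1" "v \<in> A1" | "u \<in> A1" "v \<in> B0" "h (v, t) = g' (v, t)"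
      | "v \<in> A1" "u \<in> B0" "h (u, t) = g' (u, t)"
      | "u \<in> B0" "v \<in> B0" "h (u, t) = g' (u, t)" "h (v, t) = g' (v, t)"
      using cases[of u] cases[of v] uv by blast
    then have "u = v"
    proof cases
      case 1
      then show ?thesis
        using inj_onD[OF inj_f, of "(u, t)" "(v, t)"] uv st subsetD[OF A1(5)] h_f by simp
    next
      case 2
      then show ?thesis
        using cross[of u v t] uv st h_f by simp
    next
      case 3
      then show ?thesis
        using cross[of v u t] uv st h_f by simp
    next
      case 4
      then show ?thesis
        using inj_onD[OF inj_g', of "(u, t)" "(v, t)"] uv st subsetD[OF N(3)] subsetD[OF B0V(2)] by simp
    qed
    with st show "u = v \<and> s = t"
      by simp
  qed
  have WN: "mspace (submetric (sum_metric F X) (W \<times> N)) = W \<times> N"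
    using NX WF by auto
  have h_emb: "open_lipschitz_embedding (submetric (sum_metric F X) (W \<times> N)) E h"
  proof (rule open_lipschitz_embedding_glue)
    show "inj_on h (mspace (submetric (sum_metric F X) (W \<times> N)))"
      unfolding WN by (rule inj)
    \<comment> \<open>A box over an open set on which \<open>h\<close> coincides with a known
      embedding \<open>k\<close> is admissible in the cover required for gluing.\<close>
    have piece: "openin (mtopology_of (submetric (sum_metric F X) (W \<times> N))) (G \<times> N) \<and>
        open_lipschitz_embedding (submetric (submetric (sum_metric F X) (W \<times> N)) (G \<times> N)) E h"
      if "openin (mtopology_of F) G" "G \<subseteq> W" "G \<subseteq> S" "\<And>x t. x \<in> G \<Longrightarrow> t \<in> N \<Longrightarrow> h (x, t) = k (x, t)"
        "open_lipschitz_embedding (submetric (sum_metric F X) (S \<times> T)) E k" "N \<subseteq> T" for G S T k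
    proof
      have GN: "openin (mtopology_of (sum_metric F X)) (G \<times> N)" "G \<times> N \<subseteq> W \<times> N"
        using that N by (auto intro: openin_sum_metric_Times)
      then show "openin (mtopology_of (submetric (sum_metric F X) (W \<times> N))) (G \<times> N)"
        unfolding mtopology_of_submetric openin_subtopology by blast
      have "open_lipschitz_embedding (submetric (sum_metric F X) (G \<times> N)) E k"
        using that(5) GN(1) by (rule open_lipschitz_embedding_submetric_mono) (use that in auto)
      then have "open_lipschitz_embedding (submetric (sum_metric F X) (G \<times> N)) E h"
        by (rule open_lipschitz_embedding_cong) (use that(4) in auto)
      then show "open_lipschitz_embedding (submetric (submetric (sum_metric F X) (W \<times> N)) (G \<times> N)) E h"
        using GN(2) by (simp only: submetric_submetric Int_absorb1)
    qed
    fix z assume "z \<in> mspace (submetric (sum_metric F X) (W \<times> N))"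
    then have "z \<in> G1 \<times> N \<or> z \<in> G3 \<times> N"
      unfolding WN W_def by auto
    moreover note piece[of G1 U f N, OF A1(1) _ _ _ f0[OF N(1) N0'(1)]]
      piece[of G3 V g' N', OF B0(1) _ _ _ g' N(3)]
    moreover have "h (x, t) = f (x, t)" if "x \<in> G1" for x t
      using that h_f A1 by blast
    moreover have "h (x, t) = g' (x, t)" if "x \<in> G3" "t \<in> N" for x t
      using that h_g' B0 B0V by blast
    moreover have "G1 \<subseteq> W" "G3 \<subseteq> W" "G1 \<subseteq> U"
      using A1 by (auto simp: W_def)
    ultimately show "\<exists>S. openin (mtopology_of (submetric (sum_metric F X) (W \<times> N))) S \<and> z \<in> S \<and>
        open_lipschitz_embedding (submetric (submetric (sum_metric F X) (W \<times> N)) S) E h"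
      using B0V by blast
  qed
  have nbhd: "nbhd_of (mtopology_of X) {b} N"
    using N NX by (auto simp: nbhd_of_def)
  have nbhd_Times: "nbhd_of (mtopology_of (sum_metric F X)) (C \<times> {b}) (G \<times> N)"
    if "openin (mtopology_of F) G" "C \<subseteq> G" for C G
    using openin_sum_metric_Times[OF that(1) N(1)] that N(2) openin_subset
    unfolding nbhd_of_def by (metis Sigma_mono empty_subsetI insert_subset order_refl)
  show ?thesis
  proof (intro exI conjI)
    show "openin (mtopology_of F) W" "nbhd_of (mtopology_of X) {b} N"
      by fact+
    show "A \<union> B \<subseteq> W"
      using A1(3) B0(3) unfolding W_def by blast
    show "lipschitz_product_chart E X p b W N h"
      using W nbhd h_emb ph hb
      by (simp add: lipschitz_product_chart_def submetric_sum_metric flip: F)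
    show "agree_near (mtopology_of (sum_metric F X)) (A \<times> {b}) (W \<times> N) h (U \<times> N1) f"
      unfolding agree_near_def
    proof (intro exI conjI)
      show "nbhd_of (mtopology_of (sum_metric F X)) (A \<times> {b}) (G1 \<times> N)"
        using A1 by (intro nbhd_Times)
      show "G1 \<times> N \<subseteq> W \<times> N \<inter> U \<times> N1" "\<forall>x\<in>G1 \<times> N. h x = f x"
        using A1(4,5) N0' h_f unfolding W_def by blast+
    qed
    show "agree_near (mtopology_of (sum_metric F X)) ((B - U) \<times> {b}) (W \<times> N) h (V \<times> N2) g"
      unfolding agree_near_def
    proof (intro exI conjI)
      \<comment> \<open>Both \<open>A1\<close> and \<open>K\<close> are compact, hence closed, and
        lie in \<open>U\<close>, so this open set contains \<open>B - U\<close>. Removing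
        \<open>A1\<close> gives \<open>h = g'\<close> there, and removing \<open>K\<close> gives
        \<open>g' = g\<close>.\<close>
      let ?G = "G3 - A1 - K"
      show "nbhd_of (mtopology_of (sum_metric F X)) ((B - U) \<times> {b}) (?G \<times> N)"
        using A1(2,5) B0(1,3) K closed by (intro nbhd_Times openin_diff) blast+
      show "?G \<times> N \<subseteq> W \<times> N \<inter> V \<times> N2"
        using B0V(3) N0' unfolding W_def by blast
      show "\<forall>x\<in>?G \<times> N. h x = g x"
        using g'K subsetD[OF N(3)] subsetD[OF B0V(3)] by (auto simp: h_def)
    qed
  qed
qed

end
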